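(* Let $\eta>0$, let $\mathsf{Z}\subset\mathbb{R}^m$ be measurable, let $\mu_z$ be a probability distribution on $\mathsf{Z}$, let $(Z_k)_{k\ge1}$ be i.i.d. with law $\mu_z$, and let $f:\mathbb{R}^d\times\mathsf{Z}\to\mathbb{R}$ be such that for every $z\in\mathsf{Z}$, $f(\cdot,z)$ is twice differentiable and strongly convex. Define for $z\in\mathsf{Z}$ $$R(z)=\sup_{x\in\mathbb{R}^d}\|I_d-\eta\nabla^2f(x,z)\|,\qquad r(z)=\liminf_{\|x\|\to\infty}\sigma_{\min}\big(I_d-\eta\nabla^2f(x,z)\big).$$ Assume: (i) $\mathbb{E}[R(Z_1)+\|\nabla f(x^\star,Z_1)\|]<\infty$ for some $x^\star\in\mathbb{R}^d$, $\mathbb{E}[\log R(Z_1)]<0$, and $\mathbb{P}(r(Z_1)>1)>0$; (ii) there exists $L>0$ with $\|\nabla f(x,z)-\nabla f(x,z')\|\le L(\|x\|+1)\|z-z'\|$ for all $z,z'\in\mathsf{Z}$, $x\in\mathbb{R}^d$; (iii) $\mu_z$ has finite $q$-th moments for some $q\ge1$; (iv) $R(Z_1)$ is non-deterministic; (v) the online SGD chain $(X_k)_{k\ge0}$ is geometrically ergodic (in Wasserstein-1), with stationary distribution $\pi$. Let $\beta>0$ be such that $\mathbb{E}[R(Z_1)^\beta]=1$, and assume $\beta>1$. Let $n\ge1$ and let $\epsilon_n\in[0,1]$ be the probability (over the dataset $Z_1,\dots,Z_n$) that the offline SGD chain $(X^{(n)}_k)_{k\ge0}$ is not Wasserstein-1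 ergodic. Then, with probability (over the dataset) at least $1-\epsilon_n$, $$\mathbf{W}_1(\pi,\pi^{(n)})\le c_0\,L\,\frac{\eta}{1-\delta_R}\,\mathbf{W}_1(\mu_z,\mu_z^{(n)}),$$ where $\pi^{(n)}$ is the stationary distribution of the offline chain, $\delta_R=\mathbb{E}[R(Z_1)]$, and $c_0=\mathbb{E}[\|X_0^{(n)}\|]+1$ with $X_0^{(n)}\sim\pi^{(n)}$ (expectation conditional on the dataset).
   Context: $\|\cdot\|$ is the Euclidean norm of vectors and the spectral norm of matrices; $\sigma_{\min}$ is the smallest singular value; $\nabla,\nabla^2$ are taken with respect to $x$. Online SGD with batch size 1: $X_{k+1}=X_k-\eta\nabla f(X_k,Z_{k+1})$. Under (i) it is known (a cited earlier result, which may be taken as given) that the chain admits a stationary distribution $\pi$ and that $\alpha,\beta>0$ with $\mathbb{E}[r(Z_1)^\alpha]=1$, $\mathbb{E}[R(Z_1)^\beta]=1$ exist. Empirical measure of the dataset: $\mu_z^{(n)}=n^{-1}\sum_{j=1}^n\delta_{Z_j}$. Offline SGD with batch size 1: $X^{(n)}_{k+1}=X^{(n)}_k-\eta\nabla f(X^{(n)}_k,\hat Z^{(n)}_{k+1})$, where, conditionally on the dataset, $(\hat Z^{(n)}_k)_{k\ge1}$ are i.i.d. with law $\mu_z^{(n)}$. Wasserstein-1 distance: $\mathbf{W}_1(\mu,\nu)=\inf_{\gamma}\int\|x-y\|\,d\gamma(x,y)$, the infimum over couplings $\gamma$ of $\mu,\nu$. A discrete-time Markov chain $(Y_k)_{k\ge0}$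 is (Wasserstein-1) ergodic if it admits a stationary distribution $\pi_Y$ with $\lim_{k\to\infty}\mathbf{W}_1(\mathcal{L}(Y_k),\pi_Y)=0$, where $\mathcal{L}(Y_k)$ is the law of $Y_k$, and (Wasserstein-1) geometrically ergodic if there exist $C\ge0$ and $\rho\in(0,1)$ with $\mathbf{W}_1(\mathcal{L}(Y_k),\pi_Y)\le Ce^{-\rho k}$ for all $k\ge0$. For the offline chain ergodicity is understood conditionally on the dataset. *)

theory Defs
  imports "HOL-Probability.Probability"
begin

definition grad :: "('a::real_inner \<Rightarrow> real) \<Rightarrow> 'a \<Rightarrow> 'a" where
  "grad g x = (THE D. GDERIV g x :> D)"

lemma grad_eqI:
  assumes "GDERIV g x :> D"
  shows "grad g x = D"
  unfolding grad_def
proof (rule the_equality, rule assms)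
  fix D' assume "GDERIV g x :> D'"
  then have "(\<lambda>h. h \<bullet> D') = (\<lambda>h. h \<bullet> D)"
    using assms unfolding gderiv_def by (rule has_derivative_unique)
  then show "D' = D" by (metis vector_eq_ldot)
qed

definition hessian :: "(real^'d \<Rightarrow> real) \<Rightarrow> real^'d \<Rightarrow> real^'d^'d" where
  "hessian g x = matrix (frechet_derivative (grad g) (at x))"

definition twice_differentiable :: "(real^'d \<Rightarrow> real) \<Rightarrow> bool" where
  "twice_differentiable g \<longleftrightarrow>
     (\<forall>x. g differentiable at x) \<and> (\<forall>x. grad g differentiable at x)"

definition strongly_convex :: "('a::real_normed_vector \<Rightarrow> real) \<Rightarrow> bool" where
  "strongly_convex g \<longleftrightarrow> (\<exists>m>0. \<forall>x y. \<forall>t\<in>{0..1}.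
     g (t *\<^sub>R x + (1 - t) *\<^sub>R y)
       \<le> t * g x + (1 - t) * g y - m / 2 * t * (1 - t) * (norm (x - y))\<^sup>2)"

definition spectral_norm :: "real^'n^'m \<Rightarrow> real" where
  "spectral_norm A = onorm (\<lambda>v. A *v v)"

definition singular_values :: "real^'n^'n \<Rightarrow> real set" where
  "singular_values A =
     {s. 0 \<le> s \<and> (\<exists>v. v \<noteq> 0 \<and> (transpose A ** A) *v v = s\<^sup>2 *\<^sub>R v)}"

definition sigma_min :: "real^'n^'n \<Rightarrow> real" where
  "sigma_min A = Min (singular_values A)"

text \<open>The supremum and the lower limit below may be infinite at some data points.\<close>

definition R_fun :: "real \<Rightarrow> (real^'d \<Rightarrow> 'z \<Rightarrow> real) \<Rightarrow> 'z \<Rightarrow> ennreal" where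
  "R_fun \<eta> f z =
     (SUP x. ennreal (spectral_norm (mat 1 - \<eta> *\<^sub>R hessian (\<lambda>x. f x z) x)))"

definition r_fun :: "real \<Rightarrow> (real^'d \<Rightarrow> 'z \<Rightarrow> real) \<Rightarrow> 'z \<Rightarrow> ennreal" where
  "r_fun \<eta> f z =
     Liminf at_infinity
       (\<lambda>x. ennreal (sigma_min (mat 1 - \<eta> *\<^sub>R hessian (\<lambda>x. f x z) x)))"

definition log_ext :: "ennreal \<Rightarrow> ereal" where
  "log_ext a = (if a = 0 then - \<infinity> else if a = \<infinity> then \<infinity> else ereal (ln (enn2real a)))"

text \<open>
  Positive part minus negative part, since the expectation of a logarithm may be \<open>- \<infinity>\<close>.
  In the undefined case the value is \<open>\<infinity> - \<infinity> = \<infinity>\<close>, so that a strict upper bound on the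
  expectation includes its existence.
\<close>

definition expectation_ext :: "'w measure \<Rightarrow> ('w \<Rightarrow> ereal) \<Rightarrow> ereal" where
  "expectation_ext M g =
     enn2ereal (\<integral>\<^sup>+\<omega>. e2ennreal (g \<omega>) \<partial>M) - enn2ereal (\<integral>\<^sup>+\<omega>. e2ennreal (- g \<omega>) \<partial>M)"

definition couplings :: "'a measure \<Rightarrow> 'a measure \<Rightarrow> ('a \<times> 'a) measure set" where
  "couplings \<mu> \<nu> = {\<gamma>. sets \<gamma> = sets (\<mu> \<Otimes>\<^sub>M \<nu>) \<and> distr \<gamma> \<mu> fst = \<mu> \<and> distr \<gamma> \<nu> snd = \<nu>}"

definition W1 :: "'a::real_normed_vector measure \<Rightarrow> 'a measure \<Rightarrow> ennreal" where
  "W1 \<mu> \<nu> = (INF \<gamma>\<in>couplings \<mu> \<nu>. \<integral>\<^sup>+(x, y). ennreal (norm (x - y)) \<partial>\<gamma>)"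

definition stationary_distribution ::
    "('a::topological_space \<Rightarrow> 'a measure) \<Rightarrow> 'a measure \<Rightarrow> bool" where
  "stationary_distribution K \<pi> \<longleftrightarrow>
     prob_space \<pi> \<and> sets \<pi> = sets borel \<and> \<pi> \<bind> K = \<pi>"

text \<open>
  In the following, \<open>Y\<close> is a chain on the probability space \<open>N\<close> with transition kernel \<open>K\<close>.
\<close>

definition W1_ergodic_to ::
    "'w measure \<Rightarrow> (nat \<Rightarrow> 'w \<Rightarrow> 'a::real_normed_vector) \<Rightarrow> ('a \<Rightarrow> 'a measure) \<Rightarrow> 'a measure \<Rightarrow> bool" where
  "W1_ergodic_to N Y K \<pi> \<longleftrightarrow>
     stationary_distribution K \<pi> \<and> (\<lambda>k. W1 (distr N borel (Y k)) \<pi>) \<longlonglongrightarrow> 0"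

definition W1_ergodic ::
    "'w measure \<Rightarrow> (nat \<Rightarrow> 'w \<Rightarrow> 'a::real_normed_vector) \<Rightarrow> ('a \<Rightarrow> 'a measure) \<Rightarrow> bool" where
  "W1_ergodic N Y K \<longleftrightarrow> (\<exists>\<pi>. W1_ergodic_to N Y K \<pi>)"

definition W1_geometrically_ergodic_to ::
    "'w measure \<Rightarrow> (nat \<Rightarrow> 'w \<Rightarrow> 'a::real_normed_vector) \<Rightarrow> ('a \<Rightarrow> 'a measure) \<Rightarrow> 'a measure \<Rightarrow> bool" where
  "W1_geometrically_ergodic_to N Y K \<pi> \<longleftrightarrow>
     stationary_distribution K \<pi> \<and>
     (\<exists>C\<ge>0. \<exists>\<rho>\<in>{0<..<1}. \<forall>k. W1 (distr N borel (Y k)) \<pi> \<le> ennreal (C * exp (- \<rho> * real k)))"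

definition iid :: "'w measure \<Rightarrow> 'z measure \<Rightarrow> (nat \<Rightarrow> 'w \<Rightarrow> 'z) \<Rightarrow> nat set \<Rightarrow> bool" where
  "iid N \<mu> \<zeta> I \<longleftrightarrow>
     prob_space.indep_vars N (\<lambda>_. \<mu>) \<zeta> I \<and> (\<forall>k\<in>I. distr N \<mu> (\<zeta> k) = \<mu>)"

definition sgd_step :: "real \<Rightarrow> (real^'d \<Rightarrow> 'z \<Rightarrow> real) \<Rightarrow> real^'d \<Rightarrow> 'z \<Rightarrow> real^'d" where
  "sgd_step \<eta> f x z = x - \<eta> *\<^sub>R grad (\<lambda>x. f x z) x"

definition sgd_kernel ::
    "real \<Rightarrow> (real^'d \<Rightarrow> 'z \<Rightarrow> real) \<Rightarrow> 'z measure \<Rightarrow> real^'d \<Rightarrow> (real^'d) measure" where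
  "sgd_kernel \<eta> f \<mu> x = distr \<mu> borel (sgd_step \<eta> f x)"

text \<open>
  \<open>X\<close> is an SGD chain on the probability space \<open>N\<close>, started independently of the i.i.d. data
  stream \<open>\<zeta> 1, \<zeta> 2, \<dots>\<close> of law \<open>\<mu>\<close>. Independence of \<open>X 0\<close> from the stream is written with
  \<open>indep_set\<close> because \<open>indep_var\<close> requires both variables to have the same value type.
\<close>

definition sgd_chain ::
    "'w measure \<Rightarrow> real \<Rightarrow> (real^'d \<Rightarrow> 'z \<Rightarrow> real) \<Rightarrow> 'z measure \<Rightarrow>
     (nat \<Rightarrow> 'w \<Rightarrow> real^'d) \<Rightarrow> (nat \<Rightarrow> 'w \<Rightarrow> 'z) \<Rightarrow> bool" where
  "sgd_chain N \<eta> f \<mu> X \<zeta> \<longleftrightarrow>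
     prob_space N \<and> iid N \<mu> \<zeta> {1..} \<and> X 0 \<in> borel_measurable N \<and>
     prob_space.indep_set N
       {X 0 -` A \<inter> space N | A. A \<in> sets borel}
       {(\<lambda>\<omega>. \<lambda>k\<in>{1..}. \<zeta> k \<omega>) -` B \<inter> space N | B. B \<in> sets (Pi\<^sub>M {1..} (\<lambda>_. \<mu>))} \<and>
     (\<forall>k. \<forall>\<omega>\<in>space N. X (Suc k) \<omega> = sgd_step \<eta> f (X k \<omega>) (\<zeta> (Suc k) \<omega>))"

text \<open>
  The law of \<open>D J\<close> with \<open>J\<close> uniform on \<open>{1..n}\<close>, on the measurable space underlying \<open>\<mu>\<close>;
  it is the average of the point masses at \<open>D 1, \<dots>, D n\<close>.
\<close>

definition empirical_measure :: "'z measure \<Rightarrow> nat \<Rightarrow> (nat \<Rightarrow> 'z) \<Rightarrow> 'z measure" where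
  "empirical_measure \<mu> n D = distr (uniform_count_measure {1..n}) \<mu> D"

lemma emeasure_empirical_measure:
  assumes "1 \<le> n" "D \<in> {1..n} \<rightarrow> space \<mu>" "A \<in> sets \<mu>"
  shows "emeasure (empirical_measure \<mu> n D) A
           = ennreal ((\<Sum>j=1..n. indicator A (D j)) / real n)"
proof -
  have "D \<in> measurable (uniform_count_measure {1..n}) \<mu>"
    using assms(2) by (auto simp: measurable_def uniform_count_measure_def space_point_measure
        sets_point_measure)
  then have "emeasure (empirical_measure \<mu> n D) A
      = emeasure (uniform_count_measure {1..n}) (D -` A \<inter> {1..n})"
    unfolding empirical_measure_def using assms(3)
    by (simp add: emeasure_distr space_uniform_count_measure)
  also have "\<dots> = ennreal (card (D -` A \<inter> {1..n}) / n)"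
    by (subst emeasure_uniform_count_measure) (auto simp: Int_commute)
  also have "real (card (D -` A \<inter> {1..n})) = (\<Sum>j=1..n. indicator (D -` A) j)"
    by (simp add: indicator_def vimage_def Int_commute)
  finally show ?thesis by (simp add: indicator_vimage)
qed

end

theory Submission
  imports Defs
begin

text \<open>
  Couple \<open>\<pi>\<close> with \<open>\<pi>n\<close> and, independently, \<open>\<mu>z\<close> with \<open>\<mu>n\<close>, and move both components by one SGD
  step. By stationarity the result is again a coupling of \<open>\<pi>\<close> and \<open>\<pi>n\<close>, and minimising its cost gives
  \<open>W1 \<pi> \<pi>n \<le> \<delta>R * W1 \<pi> \<pi>n + \<eta> * L * (E|x| + 1) * W1 \<mu>z \<mu>n\<close>. Since \<open>\<beta> > 1\<close> and \<open>R\<close> is not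
  constant, \<open>\<delta>R < 1\<close> by strict convexity of the power function, so the first term is absorbed on the
  left as soon as \<open>W1 \<pi> \<pi>n\<close> is finite. For this, \<open>\<pi>\<close> has a finite first moment because the mean
  contraction is a Lyapunov drift condition. The measure \<open>\<pi>n\<close> may fail to have one, but then the
  claimed bound is infinite unless \<open>W1 \<mu>z \<mu>n = 0\<close>, in which case the drift condition passes to the
  offline kernel.
\<close>

section \<open>Couplings and the Wasserstein-1 distance\<close>

text \<open>An infimum in \<open>ennreal\<close> is the limit of a decreasing sequence of values,
  and multiplication by a finite \<open>k\<close> is continuous along it; for \<open>k = top\<close>
  continuity would fail at infimum 0. This carries bounds that hold for each coupling over to
  \<open>W1\<close>.\<close>

lemma le_add_mult_INF_ennreal:
  fixes f :: "'a \<Rightarrow> ennreal"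
  assumes "I \<noteq> {}" "k < top" "\<And>i. i \<in> I \<Longrightarrow> u \<le> a + k * f i"
  shows "u \<le> a + k * (INF i\<in>I. f i)"
proof -
  obtain g :: "nat \<Rightarrow> ennreal" where g: "decseq g" "range g \<subseteq> f ` I" "Inf (f ` I) = (INF n. g n)"
    using ennreal_Inf_countable_INF[of "f ` I"] assms(1) by auto
  have "(\<lambda>n. a + k * g n) \<longlonglongrightarrow> a + k * (INF n. g n)"
    using g(1) assms(2) by (intro tendsto_add tendsto_const ennreal_tendsto_cmult LIMSEQ_INF)
  moreover have "u \<le> a + k * g n" for n
    using g(2) assms(3) by (metis image_iff range_subsetD)
  ultimately show ?thesis
    unfolding g(3) by (intro LIMSEQ_le_const) auto
qed

lemma couplings_prob_space:
  assumes "prob_space \<mu>" "\<gamma> \<in> couplings \<mu> \<nu>"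
  shows "prob_space \<gamma>"
proof (rule prob_space_distrD)
  show "fst \<in> \<gamma> \<rightarrow>\<^sub>M \<mu>"
    using assms(2) by (simp add: couplings_def cong: measurable_cong_sets)
  show "prob_space (distr \<gamma> \<mu> fst)"
    using assms by (simp add: couplings_def)
qed

lemma nn_integral_coupling_fst:
  assumes "\<gamma> \<in> couplings \<mu> \<nu>" "g \<in> borel_measurable \<mu>"
  shows "(\<integral>\<^sup>+p. g (fst p) \<partial>\<gamma>) = (\<integral>\<^sup>+x. g x \<partial>\<mu>)"
proof -
  have [measurable_cong]: "sets \<gamma> = sets (\<mu> \<Otimes>\<^sub>M \<nu>)" and d: "distr \<gamma> \<mu> fst = \<mu>"
    using assms(1) by (auto simp: couplings_def)
  have "(\<integral>\<^sup>+x. g x \<partial>distr \<gamma> \<mu> fst) = (\<integral>\<^sup>+p. g (fst p) \<partial>\<gamma>)"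
    using assms(2) by (intro nn_integral_distr) simp_all
  then show ?thesis by (simp add: d)
qed

lemma nn_integral_coupling_snd:
  assumes "\<gamma> \<in> couplings \<mu> \<nu>" "g \<in> borel_measurable \<nu>"
  shows "(\<integral>\<^sup>+p. g (snd p) \<partial>\<gamma>) = (\<integral>\<^sup>+x. g x \<partial>\<nu>)"
proof -
  have [measurable_cong]: "sets \<gamma> = sets (\<mu> \<Otimes>\<^sub>M \<nu>)" and d: "distr \<gamma> \<nu> snd = \<nu>"
    using assms(1) by (auto simp: couplings_def)
  have "(\<integral>\<^sup>+x. g x \<partial>distr \<gamma> \<nu> snd) = (\<integral>\<^sup>+p. g (snd p) \<partial>\<gamma>)"
    using assms(2) by (intro nn_integral_distr) simp_all
  then show ?thesis by (simp add: d)
qed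

lemma pair_measure_couplings:
  assumes "prob_space \<mu>" "prob_space \<nu>"
  shows "\<mu> \<Otimes>\<^sub>M \<nu> \<in> couplings \<mu> \<nu>"
proof -
  interpret m: prob_space \<mu> by fact
  interpret n: prob_space \<nu> by fact
  interpret pair_prob_space \<mu> \<nu> ..
  have "distr (\<mu> \<Otimes>\<^sub>M \<nu>) \<nu> snd = \<nu>"
  proof (rule measure_eqI)
    fix A assume A: "A \<in> sets (distr (\<mu> \<Otimes>\<^sub>M \<nu>) \<nu> snd)"
    then have "emeasure (distr (\<mu> \<Otimes>\<^sub>M \<nu>) \<nu> snd) A = emeasure (\<mu> \<Otimes>\<^sub>M \<nu>) (space \<mu> \<times> A)"
      by (auto simp: emeasure_distr space_pair_measure dest: sets.sets_into_space
          intro!: arg_cong2[where f=emeasure])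
    also have "\<dots> = emeasure \<nu> A"
      using A by (subst n.emeasure_pair_measure_Times) (auto simp: m.emeasure_space_1)
    finally show "emeasure (distr (\<mu> \<Otimes>\<^sub>M \<nu>) \<nu> snd) A = emeasure \<nu> A" .
  qed simp
  moreover have "distr (\<mu> \<Otimes>\<^sub>M \<nu>) \<mu> fst = \<mu>"
    by (rule n.distr_pair_fst)
  ultimately show ?thesis by (simp add: couplings_def)
qed

text \<open>The independent coupling has at most this cost, by the triangle inequality through
  \<open>a\<close> and \<open>b\<close>. The bound serves to show that \<open>W1\<close> is
  finite.\<close>

lemma W1_le_moments:
  fixes \<pi> \<pi>' :: "'a::{real_normed_vector, second_countable_topology} measure"
  assumes "prob_space \<pi>" "prob_space \<pi>'" and [measurable_cong]: "sets \<pi> = sets borel" "sets \<pi>' = sets borel"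
  shows "W1 \<pi> \<pi>' \<le> (\<integral>\<^sup>+x. norm (x - a) \<partial>\<pi>) + (\<integral>\<^sup>+y. norm (y - b) \<partial>\<pi>') + norm (a - b)"
proof -
  let ?\<Gamma> = "\<pi> \<Otimes>\<^sub>M \<pi>'"
  interpret \<Gamma>: prob_space ?\<Gamma>
    using assms by (intro prob_space_pair)
  have \<Gamma>: "?\<Gamma> \<in> couplings \<pi> \<pi>'"
    using assms(1,2) by (rule pair_measure_couplings)
  have "W1 \<pi> \<pi>' \<le> (\<integral>\<^sup>+(x, y). ennreal (norm (x - y)) \<partial>?\<Gamma>)"
    unfolding W1_def using \<Gamma> by (rule INF_lower)
  also have "\<dots> \<le> (\<integral>\<^sup>+p. (ennreal (norm (fst p - a)) + ennreal (norm (snd p - b))) + ennreal (norm (a - b)) \<partial>?\<Gamma>)"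
  proof (rule nn_integral_mono, clarify)
    fix x y
    have "norm (x - y) \<le> norm (x - a) + norm (y - b) + norm (a - b)"
      using norm_triangle_ineq[of "x - a" "a - y"] norm_triangle_ineq[of "a - b" "b - y"]
        norm_minus_commute[of b y] by simp
    then show "ennreal (norm (x - y)) \<le> (ennreal (norm (fst (x, y) - a)) + ennreal (norm (snd (x, y) - b))) + ennreal (norm (a - b))"
      by (simp flip: ennreal_plus)
  qed
  also have "\<dots> = (\<integral>\<^sup>+x. norm (x - a) \<partial>\<pi>) + (\<integral>\<^sup>+y. norm (y - b) \<partial>\<pi>') + norm (a - b)"
    using nn_integral_coupling_fst[OF \<Gamma>, of "\<lambda>x. norm (x - a)"]
      nn_integral_coupling_snd[OF \<Gamma>, of "\<lambda>x. norm (x - b)"]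
    by (simp add: nn_integral_add \<Gamma>.emeasure_space_1)
  finally show ?thesis .
qed

section \<open>Stationary distributions and their first moments\<close>

text \<open>Tonelli's theorem turns the average of the kernel over \<open>\<pi>\<close> into the law
  of \<open>\<phi> x z\<close> for independent \<open>x\<close> and \<open>z\<close>. In this form
  stationarity combines with couplings.\<close>

lemma stationary_distribution_distr_pair:
  fixes \<pi> :: "'a::second_countable_topology measure"
  assumes "prob_space \<mu>" and \<phi>[measurable]: "case_prod \<phi> \<in> borel \<Otimes>\<^sub>M \<mu> \<rightarrow>\<^sub>M borel"
    and st: "stationary_distribution (\<lambda>x. distr \<mu> borel (\<phi> x)) \<pi>"
  shows "distr (\<pi> \<Otimes>\<^sub>M \<mu>) borel (case_prod \<phi>) = \<pi>"
proof -
  interpret \<mu>: prob_space \<mu> by fact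
  interpret \<pi>: prob_space \<pi> using st by (simp add: stationary_distribution_def)
  have s[measurable_cong]: "sets \<pi> = sets borel" using st by (simp add: stationary_distribution_def)
  have K: "(\<lambda>x. distr \<mu> borel (\<phi> x)) \<in> \<pi> \<rightarrow>\<^sub>M subprob_algebra borel"
    by (rule measurable_distr2[where M=\<mu>]) (auto simp: space_subprob_algebra \<mu>.subprob_space_axioms)
  show ?thesis
  proof (rule measure_eqI)
    fix A assume "A \<in> sets (distr (\<pi> \<Otimes>\<^sub>M \<mu>) borel (case_prod \<phi>))"
    then have A[measurable]: "A \<in> sets borel" by simp
    have "emeasure \<pi> A = emeasure (\<pi> \<bind> (\<lambda>x. distr \<mu> borel (\<phi> x))) A"
      using st by (simp add: stationary_distribution_def)
    also have "\<dots> = (\<integral>\<^sup>+x. emeasure (distr \<mu> borel (\<phi> x)) A \<partial>\<pi>)"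
      by (rule emeasure_bind[OF \<pi>.not_empty K A])
    also have "\<dots> = (\<integral>\<^sup>+x. \<integral>\<^sup>+z. indicator A (\<phi> x z) \<partial>\<mu> \<partial>\<pi>)"
    proof (rule nn_integral_cong)
      fix x
      have [measurable]: "\<phi> x \<in> \<mu> \<rightarrow>\<^sub>M borel"
        using measurable_compose[OF measurable_Pair1' \<phi>, of x] by simp
      have "emeasure (distr \<mu> borel (\<phi> x)) A = (\<integral>\<^sup>+y. indicator A y \<partial>distr \<mu> borel (\<phi> x))"
        by simp
      also have "\<dots> = (\<integral>\<^sup>+z. indicator A (\<phi> x z) \<partial>\<mu>)"
        by (rule nn_integral_distr) auto
      finally show "emeasure (distr \<mu> borel (\<phi> x)) A = (\<integral>\<^sup>+z. indicator A (\<phi> x z) \<partial>\<mu>)" .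
    qed
    also have "\<dots> = (\<integral>\<^sup>+p. indicator A (case_prod \<phi> p) \<partial>(\<pi> \<Otimes>\<^sub>M \<mu>))"
      by (subst \<mu>.nn_integral_fst[symmetric]) auto
    also have "\<dots> = (\<integral>\<^sup>+y. indicator A y \<partial>distr (\<pi> \<Otimes>\<^sub>M \<mu>) borel (case_prod \<phi>))"
      by (rule nn_integral_distr[symmetric]) auto
    also have "\<dots> = emeasure (distr (\<pi> \<Otimes>\<^sub>M \<mu>) borel (case_prod \<phi>)) A"
      by simp
    finally show "emeasure (distr (\<pi> \<Otimes>\<^sub>M \<mu>) borel (case_prod \<phi>)) A = emeasure \<pi> A" ..
  qed (simp add: s)
qed

text \<open>Iterating the drift k times from \<open>x\<close> bounds the mean distance to
  \<open>a\<close> by \<open>\<delta> ^ k * norm (x - a)\<close> plus a geometric sum. Under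
  \<open>\<pi>\<close> the law does not depend on k, so the starting point is forgotten as k grows
  and \<open>b / (1 - \<delta>)\<close> remains.\<close>

lemma stationary_moment_finite:
  fixes \<phi> :: "'a::{real_normed_vector, second_countable_topology} \<Rightarrow> 'z \<Rightarrow> 'a"
  assumes "prob_space \<mu>" and \<phi>[measurable]: "case_prod \<phi> \<in> borel \<Otimes>\<^sub>M \<mu> \<rightarrow>\<^sub>M borel"
    and st: "stationary_distribution (\<lambda>x. distr \<mu> borel (\<phi> x)) \<pi>"
    and \<delta>: "0 \<le> \<delta>" "\<delta> < 1" and b: "0 \<le> b"
    and drift: "\<And>x. (\<integral>\<^sup>+z. norm (\<phi> x z - a) \<partial>\<mu>) \<le> ennreal (\<delta> * norm (x - a) + b)"
  shows "(\<integral>\<^sup>+x. norm (x - a) \<partial>\<pi>) < \<infinity>"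
proof -
  interpret \<mu>: prob_space \<mu> by fact
  interpret \<pi>: prob_space \<pi> using st by (simp add: stationary_distribution_def)
  have s[measurable_cong]: "sets \<pi> = sets borel" using st by (simp add: stationary_distribution_def)
  have [measurable]: "\<phi> x \<in> \<mu> \<rightarrow>\<^sub>M borel" for x
    using measurable_compose[OF measurable_Pair1' \<phi>, of x] by simp
  \<comment> \<open>The moment is not known to be finite, so the drift is iterated on the truncated function
      \<open>min m (c k + \<delta> ^ k * norm (x - a))\<close>, whose integral is nondecreasing in \<open>k\<close>.\<close>
  define c where "c k = b * (\<Sum>i<k. \<delta> ^ i)" for k :: nat
  have c0: "0 \<le> c k" for k using \<delta> b by (simp add: c_def sum_nonneg)
  have cB: "c k \<le> b / (1 - \<delta>)" for k
  proof -
    have "(\<Sum>i<k. \<delta> ^ i) \<le> 1 / (1 - \<delta>)"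
      using \<delta> by (simp add: sum_gp_strict divide_right_mono)
    from mult_left_mono[OF this b] show ?thesis by (simp add: c_def)
  qed
  have step: "(\<integral>\<^sup>+x. min (ennreal m) (c k + \<delta> ^ k * norm (x - a)) \<partial>\<pi>)
       \<le> (\<integral>\<^sup>+x. min (ennreal m) (c (Suc k) + \<delta> ^ Suc k * norm (x - a)) \<partial>\<pi>)" for m k
  proof -
    have "(\<integral>\<^sup>+x. min (ennreal m) (c k + \<delta> ^ k * norm (x - a)) \<partial>\<pi>)
      = (\<integral>\<^sup>+x. min (ennreal m) (c k + \<delta> ^ k * norm (x - a)) \<partial>distr (\<pi> \<Otimes>\<^sub>M \<mu>) borel (case_prod \<phi>))"
      by (simp add: stationary_distribution_distr_pair[OF assms(1,2) st])
    also have "\<dots> = (\<integral>\<^sup>+p. min (ennreal m) (c k + \<delta> ^ k * norm (case_prod \<phi> p - a)) \<partial>(\<pi> \<Otimes>\<^sub>M \<mu>))"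
      by (rule nn_integral_distr) auto
    also have "\<dots> = (\<integral>\<^sup>+x. \<integral>\<^sup>+z. min (ennreal m) (c k + \<delta> ^ k * norm (\<phi> x z - a)) \<partial>\<mu> \<partial>\<pi>)"
      by (subst \<mu>.nn_integral_fst[symmetric]) auto
    \<comment> \<open>The integral over one step is bounded in two ways: by \<open>m\<close>, since
      \<open>\<mu>\<close> has mass 1, and by the drift applied without truncation, where
      \<open>c (Suc k) = c k + \<delta> ^ k * b\<close>.\<close>
    also have "\<dots> \<le> (\<integral>\<^sup>+x. min (ennreal m) (c (Suc k) + \<delta> ^ Suc k * norm (x - a)) \<partial>\<pi>)"
    proof (rule nn_integral_mono, rule min.boundedI)
      fix x
      have "(\<integral>\<^sup>+z. min (ennreal m) (c k + \<delta> ^ k * norm (\<phi> x z - a)) \<partial>\<mu>) \<le> (\<integral>\<^sup>+z. ennreal m \<partial>\<mu>)"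
        by (rule nn_integral_mono) simp
      then show "(\<integral>\<^sup>+z. min (ennreal m) (c k + \<delta> ^ k * norm (\<phi> x z - a)) \<partial>\<mu>) \<le> ennreal m"
        by (simp add: \<mu>.emeasure_space_1)
      have "(\<integral>\<^sup>+z. min (ennreal m) (c k + \<delta> ^ k * norm (\<phi> x z - a)) \<partial>\<mu>)
        \<le> (\<integral>\<^sup>+z. ennreal (c k) + ennreal (\<delta> ^ k) * norm (\<phi> x z - a) \<partial>\<mu>)"
        using c0 \<delta> by (intro nn_integral_mono) (simp add: ennreal_mult min.coboundedI2)
      also have "\<dots> = c k + ennreal (\<delta> ^ k) * (\<integral>\<^sup>+z. norm (\<phi> x z - a) \<partial>\<mu>)"
        by (simp add: nn_integral_add nn_integral_cmult \<mu>.emeasure_space_1)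
      also have "\<dots> \<le> c k + ennreal (\<delta> ^ k) * ennreal (\<delta> * norm (x - a) + b)"
        by (intro add_left_mono mult_left_mono drift) simp
      also have "\<dots> = ennreal (c (Suc k) + \<delta> ^ Suc k * norm (x - a))"
        using c0 \<delta> b by (simp add: c_def algebra_simps flip: ennreal_mult ennreal_plus)
      finally show "(\<integral>\<^sup>+z. min (ennreal m) (c k + \<delta> ^ k * norm (\<phi> x z - a)) \<partial>\<mu>)
        \<le> ennreal (c (Suc k) + \<delta> ^ Suc k * norm (x - a))" .
    qed
    finally show ?thesis .
  qed
  have trunc: "(\<integral>\<^sup>+x. min (ennreal m) (norm (x - a)) \<partial>\<pi>) \<le> b / (1 - \<delta>)" if "0 \<le> m" for m
  proof -
    let ?B = "b / (1 - \<delta>)"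
    have B0: "0 \<le> ?B" using b \<delta> by simp
    have le: "(\<integral>\<^sup>+x. min (ennreal m) (norm (x - a)) \<partial>\<pi>)
        \<le> (\<integral>\<^sup>+x. min (ennreal m) (?B + \<delta> ^ k * norm (x - a)) \<partial>\<pi>)" for k
    proof -
      have "(\<integral>\<^sup>+x. min (ennreal m) (norm (x - a)) \<partial>\<pi>)
        \<le> (\<integral>\<^sup>+x. min (ennreal m) (c k + \<delta> ^ k * norm (x - a)) \<partial>\<pi>)"
      proof (induction k)
        case (Suc k) then show ?case using step order_trans by blast
      qed (simp add: c_def)
      also have "\<dots> \<le> (\<integral>\<^sup>+x. min (ennreal m) (?B + \<delta> ^ k * norm (x - a)) \<partial>\<pi>)"
        by (intro nn_integral_mono min.mono order_refl ennreal_leI add_right_mono cB)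
      finally show ?thesis .
    qed
    \<comment> \<open>The constant \<open>m\<close> is an integrable majorant, so the term with
      \<open>\<delta> ^ k\<close> vanishes in the limit although \<open>norm (x - a)\<close> is not
      yet known to be integrable.\<close>
    have "(\<lambda>k. \<integral>\<^sup>+x. min (ennreal m) (?B + \<delta> ^ k * norm (x - a)) \<partial>\<pi>)
        \<longlonglongrightarrow> (\<integral>\<^sup>+x. min (ennreal m) ?B \<partial>\<pi>)"
    proof (rule nn_integral_dominated_convergence[where w="\<lambda>_. ennreal m"])
      show "(\<integral>\<^sup>+x. ennreal m \<partial>\<pi>) < \<infinity>" by (simp add: \<pi>.emeasure_space_1)
      show "AE x in \<pi>. (\<lambda>k. min (ennreal m) (?B + \<delta> ^ k * norm (x - a))) \<longlonglongrightarrow> min (ennreal m) ?B"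
      proof (rule AE_I2)
        fix x
        have "(\<lambda>k. ?B + \<delta> ^ k * norm (x - a)) \<longlonglongrightarrow> ?B + 0 * norm (x - a)"
          using \<delta> by (intro tendsto_intros LIMSEQ_power_zero) simp
        then show "(\<lambda>k. min (ennreal m) (?B + \<delta> ^ k * norm (x - a))) \<longlonglongrightarrow> min (ennreal m) ?B"
          by (intro tendsto_min tendsto_const tendsto_ennrealI) simp
      qed
    qed auto
    then have "(\<integral>\<^sup>+x. min (ennreal m) (norm (x - a)) \<partial>\<pi>) \<le> (\<integral>\<^sup>+x. min (ennreal m) ?B \<partial>\<pi>)"
      using le by (intro LIMSEQ_le_const) auto
    also have "\<dots> \<le> ?B" by (simp add: \<pi>.emeasure_space_1)
    finally show ?thesis .
  qed
  \<comment> \<open>The bound in \<open>trunc\<close> does not depend on \<open>m\<close>, so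
    monotone convergence removes the truncation.\<close>
  have "(\<lambda>m. \<integral>\<^sup>+x. min (ennreal (real m)) (norm (x - a)) \<partial>\<pi>) \<longlonglongrightarrow> (\<integral>\<^sup>+x. norm (x - a) \<partial>\<pi>)"
  proof (rule nn_integral_LIMSEQ)
    show "incseq (\<lambda>m x. min (ennreal (real m)) (ennreal (norm (x - a))))"
      by (auto simp: incseq_def le_fun_def intro!: min.mono ennreal_leI simp del: min_less_iff_conj min.bounded_iff)
    fix x
    have "eventually (\<lambda>m. min (ennreal (real m)) (norm (x - a)) = norm (x - a)) sequentially"
      using eventually_ge_at_top[of "nat \<lceil>norm (x - a)\<rceil>"]
      by eventually_elim (auto intro!: min.absorb2 ennreal_leI)
    then show "(\<lambda>m. min (ennreal (real m)) (norm (x - a))) \<longlonglongrightarrow> norm (x - a)"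
      by (rule tendsto_eventually)
  qed auto
  then have "(\<integral>\<^sup>+x. norm (x - a) \<partial>\<pi>) \<le> b / (1 - \<delta>)"
    by (rule LIMSEQ_le_const2) (use trunc in auto)
  then show ?thesis
    by (simp add: order_le_less_trans)
qed

section \<open>Comparison of two stationary distributions\<close>

text \<open>The couplings \<open>\<Gamma>\<close> and \<open>\<gamma>\<close> are combined as an
  independent product, so that both the contraction term and the noise term factor into separate
  integrals. The moment of \<open>\<pi>'\<close> appears because the noise is compared at the second
  component.\<close>

lemma W1_stationary_le_coupling:
  fixes \<phi> :: "'a::{real_normed_vector, second_countable_topology} \<Rightarrow> 'z::real_normed_vector \<Rightarrow> 'a"
  assumes "prob_space \<mu>" "prob_space \<nu>" and s\<nu>[measurable_cong]: "sets \<nu> = sets \<mu>"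
    and diff[measurable]: "(\<lambda>p. norm (fst p - snd p)) \<in> borel_measurable (\<mu> \<Otimes>\<^sub>M \<mu>)"
    and \<phi>[measurable]: "case_prod \<phi> \<in> borel \<Otimes>\<^sub>M \<mu> \<rightarrow>\<^sub>M borel"
    and st: "stationary_distribution (\<lambda>x. distr \<mu> borel (\<phi> x)) \<pi>"
    and st': "stationary_distribution (\<lambda>x. distr \<nu> borel (\<phi> x)) \<pi>'"
    and R[measurable]: "(R :: 'z \<Rightarrow> ennreal) \<in> borel_measurable \<mu>"
    and lip: "\<And>x y z. z \<in> space \<mu> \<Longrightarrow> ennreal (norm (\<phi> x z - \<phi> y z)) \<le> R z * norm (x - y)"
    and c: "0 \<le> c"
      "\<And>x z z'. z \<in> space \<mu> \<Longrightarrow> z' \<in> space \<mu> \<Longrightarrow>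
         norm (\<phi> x z - \<phi> x z') \<le> c * (norm x + 1) * norm (z - z')"
    and \<Gamma>: "\<Gamma> \<in> couplings \<pi> \<pi>'" and \<gamma>: "\<gamma> \<in> couplings \<mu> \<nu>"
  shows "W1 \<pi> \<pi>' \<le> (\<integral>\<^sup>+z. R z \<partial>\<mu>) * (\<integral>\<^sup>+(x, y). ennreal (norm (x - y)) \<partial>\<Gamma>)
      + ennreal c * ((\<integral>\<^sup>+y. norm y \<partial>\<pi>') + 1) * (\<integral>\<^sup>+(z, z'). ennreal (norm (z - z')) \<partial>\<gamma>)"
proof -
  interpret \<mu>: prob_space \<mu> by fact
  interpret \<nu>: prob_space \<nu> by fact
  interpret \<pi>: prob_space \<pi> using st by (simp add: stationary_distribution_def)
  interpret \<pi>': prob_space \<pi>' using st' by (simp add: stationary_distribution_def)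
  interpret \<Gamma>: prob_space \<Gamma> using \<pi>.prob_space_axioms \<Gamma> by (rule couplings_prob_space)
  interpret \<gamma>: prob_space \<gamma> using \<mu>.prob_space_axioms \<gamma> by (rule couplings_prob_space)
  have s\<pi>[measurable_cong]: "sets \<pi> = sets borel" "sets \<pi>' = sets borel"
    using st st' by (auto simp: stationary_distribution_def)
  have s\<Gamma>[measurable_cong]: "sets \<Gamma> = sets (\<pi> \<Otimes>\<^sub>M \<pi>')" and \<Gamma>d: "distr \<Gamma> \<pi> fst = \<pi>" "distr \<Gamma> \<pi>' snd = \<pi>'"
    using \<Gamma> by (auto simp: couplings_def)
  have s\<gamma>[measurable_cong]: "sets \<gamma> = sets (\<mu> \<Otimes>\<^sub>M \<nu>)" and \<gamma>d: "distr \<gamma> \<mu> fst = \<mu>" "distr \<gamma> \<nu> snd = \<nu>"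
    using \<gamma> by (auto simp: couplings_def)
  have \<phi>'[measurable]: "case_prod \<phi> \<in> borel \<Otimes>\<^sub>M \<nu> \<rightarrow>\<^sub>M borel"
    using \<phi> by (simp cong: measurable_cong_sets)
  have sp: "space \<gamma> = space \<mu> \<times> space \<mu>"
    using sets_eq_imp_space_eq[OF s\<gamma>] sets_eq_imp_space_eq[OF s\<nu>] by (simp add: space_pair_measure)
  define T where "T = (\<lambda>(p :: 'a \<times> 'a, q :: 'z \<times> 'z). (\<phi> (fst p) (fst q), \<phi> (snd p) (snd q)))"
  define \<Lambda> where "\<Lambda> = distr (\<Gamma> \<Otimes>\<^sub>M \<gamma>) (borel \<Otimes>\<^sub>M borel) T"
  have T[measurable]: "T \<in> \<Gamma> \<Otimes>\<^sub>M \<gamma> \<rightarrow>\<^sub>M borel \<Otimes>\<^sub>M borel"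
    unfolding T_def by measurable
  \<comment> \<open>Under the product, \<open>fst p\<close> and \<open>fst q\<close> are independent
    with laws \<open>\<pi>\<close> and \<open>\<mu>\<close>, so stationarity returns
    \<open>\<pi>\<close> as the law of the moved first component. The second component is treated in
    the same way with \<open>\<pi>'\<close> and \<open>\<nu>\<close>.\<close>
  have "distr \<Lambda> \<pi> fst = distr (\<Gamma> \<Otimes>\<^sub>M \<gamma>) borel (\<lambda>w. case_prod \<phi> (fst (fst w), fst (snd w)))"
    unfolding \<Lambda>_def by (subst distr_distr) (auto simp: T_def comp_def case_prod_unfold s\<pi> intro!: distr_cong)
  also have "\<dots> = distr (distr (\<Gamma> \<Otimes>\<^sub>M \<gamma>) (\<pi> \<Otimes>\<^sub>M \<mu>) (\<lambda>(p, q). (fst p, fst q))) borel (case_prod \<phi>)"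
    by (subst distr_distr) (auto simp: comp_def case_prod_unfold)
  also have "\<dots> = distr (\<pi> \<Otimes>\<^sub>M \<mu>) borel (case_prod \<phi>)"
    by (subst pair_measure_distr[symmetric]) (auto simp: \<Gamma>d \<gamma>d \<mu>.sigma_finite_measure_axioms)
  finally have fst: "distr \<Lambda> \<pi> fst = \<pi>"
    by (simp add: stationary_distribution_distr_pair[OF assms(1) \<phi> st])
  have "distr \<Lambda> \<pi>' snd = distr (\<Gamma> \<Otimes>\<^sub>M \<gamma>) borel (\<lambda>w. case_prod \<phi> (snd (fst w), snd (snd w)))"
    unfolding \<Lambda>_def by (subst distr_distr) (auto simp: T_def comp_def case_prod_unfold s\<pi> intro!: distr_cong)
  also have "\<dots> = distr (distr (\<Gamma> \<Otimes>\<^sub>M \<gamma>) (\<pi>' \<Otimes>\<^sub>M \<nu>) (\<lambda>(p, q). (snd p, snd q))) borel (case_prod \<phi>)"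
    by (subst distr_distr) (auto simp: comp_def case_prod_unfold)
  also have "\<dots> = distr (\<pi>' \<Otimes>\<^sub>M \<nu>) borel (case_prod \<phi>)"
    by (subst pair_measure_distr[symmetric]) (auto simp: \<Gamma>d \<gamma>d \<nu>.sigma_finite_measure_axioms)
  finally have snd: "distr \<Lambda> \<pi>' snd = \<pi>'"
    by (simp add: stationary_distribution_distr_pair[OF assms(2) \<phi>' st'])
  have \<Lambda>: "\<Lambda> \<in> couplings \<pi> \<pi>'"
    using fst snd by (simp add: couplings_def) (simp add: \<Lambda>_def s\<pi> cong: sets_pair_measure_cong)
  have "W1 \<pi> \<pi>' \<le> (\<integral>\<^sup>+(x, y). ennreal (norm (x - y)) \<partial>\<Lambda>)"
    unfolding W1_def using \<Lambda> by (rule INF_lower)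
  also have "\<dots> = (\<integral>\<^sup>+w. ennreal (norm (\<phi> (fst (fst w)) (fst (snd w)) - \<phi> (snd (fst w)) (snd (snd w)))) \<partial>(\<Gamma> \<Otimes>\<^sub>M \<gamma>))"
    unfolding \<Lambda>_def by (subst nn_integral_distr) (auto simp: T_def case_prod_unfold)
  also have "\<dots> \<le> (\<integral>\<^sup>+w. R (fst (snd w)) * norm (fst (fst w) - snd (fst w))
      + ennreal c * (ennreal (norm (snd (fst w))) + 1) * norm (fst (snd w) - snd (snd w)) \<partial>(\<Gamma> \<Otimes>\<^sub>M \<gamma>))"
  proof (rule nn_integral_mono, clarify)
    fix x y z z' assume "((x, y), (z, z')) \<in> space (\<Gamma> \<Otimes>\<^sub>M \<gamma>)"
    then have z: "z \<in> space \<mu>" "z' \<in> space \<mu>" by (auto simp: space_pair_measure sp)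
    \<comment> \<open>The intermediate point \<open>\<phi> y z\<close> separates the two effects:
      first the state changes under the same datum, then the datum changes at the state
      \<open>y\<close>.\<close>
    have "norm (\<phi> x z - \<phi> y z') \<le> norm (\<phi> x z - \<phi> y z) + norm (\<phi> y z - \<phi> y z')"
      using norm_triangle_ineq[of "\<phi> x z - \<phi> y z" "\<phi> y z - \<phi> y z'"] by simp
    then have "ennreal (norm (\<phi> x z - \<phi> y z')) \<le> ennreal (norm (\<phi> x z - \<phi> y z)) + ennreal (norm (\<phi> y z - \<phi> y z'))"
      by (simp flip: ennreal_plus)
    also have "\<dots> \<le> R z * norm (x - y) + ennreal (c * (norm y + 1) * norm (z - z'))"
      using lip[OF z(1)] c(2)[OF z] by (intro add_mono ennreal_leI)
    also have "ennreal (c * (norm y + 1) * norm (z - z')) = ennreal c * (ennreal (norm y) + 1) * norm (z - z')"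
      using c(1) by (simp add: ennreal_mult flip: ennreal_plus ennreal_1)
    finally show "ennreal (norm (\<phi> (fst (fst ((x, y), (z, z')))) (fst (snd ((x, y), (z, z')))) - \<phi> (snd (fst ((x, y), (z, z')))) (snd (snd ((x, y), (z, z'))))))
      \<le> R (fst (snd ((x, y), (z, z')))) * norm (fst (fst ((x, y), (z, z'))) - snd (fst ((x, y), (z, z'))))
      + ennreal c * (ennreal (norm (snd (fst ((x, y), (z, z'))))) + 1) * norm (fst (snd ((x, y), (z, z'))) - snd (snd ((x, y), (z, z'))))"
      by simp
  qed
  also have "\<dots> = (\<integral>\<^sup>+p. \<integral>\<^sup>+q. R (fst q) * norm (fst p - snd p)
      + ennreal c * (ennreal (norm (snd p)) + 1) * norm (fst q - snd q) \<partial>\<gamma> \<partial>\<Gamma>)"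
    by (subst \<gamma>.nn_integral_fst[symmetric]) auto
  \<comment> \<open>\<open>R\<close> sees \<open>q\<close> only through \<open>fst q\<close>, whose
    law is \<open>\<mu>\<close>; this turns the random factor into its mean.\<close>
  also have "\<dots> = (\<integral>\<^sup>+p. (\<integral>\<^sup>+z. R z \<partial>\<mu>) * norm (fst p - snd p)
      + ennreal c * (ennreal (norm (snd p)) + 1) * (\<integral>\<^sup>+q. norm (fst q - snd q) \<partial>\<gamma>) \<partial>\<Gamma>)"
    by (simp add: nn_integral_add nn_integral_cmult nn_integral_multc nn_integral_coupling_fst[OF \<gamma> R])
  also have "\<dots> = (\<integral>\<^sup>+z. R z \<partial>\<mu>) * (\<integral>\<^sup>+p. norm (fst p - snd p) \<partial>\<Gamma>)
      + ennreal c * ((\<integral>\<^sup>+y. norm y \<partial>\<pi>') + 1) * (\<integral>\<^sup>+q. norm (fst q - snd q) \<partial>\<gamma>)"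
    using nn_integral_coupling_snd[OF \<Gamma>, of "\<lambda>y. norm y"]
    by (simp add: nn_integral_add nn_integral_cmult nn_integral_multc \<Gamma>.emeasure_space_1)
  finally show ?thesis by (simp add: case_prod_unfold)
qed

text \<open>Near-optimal choices of both couplings put \<open>\<delta> * W1 \<pi> \<pi>'\<close> on
  the right, and absorbing it gives the factor \<open>1 / (1 - \<delta>)\<close>. A single point
  \<open>a\<close> with finite mean displacement suffices for the drift, because \<open>R\<close>
  controls the change from \<open>a\<close> to any other state.\<close>

lemma W1_stationary_perturbation:
  fixes \<phi> :: "'a::{real_normed_vector, second_countable_topology} \<Rightarrow> 'z::real_normed_vector \<Rightarrow> 'a"
  assumes "prob_space \<mu>" "prob_space \<nu>" and s\<nu>[measurable_cong]: "sets \<nu> = sets \<mu>"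
    and diff[measurable]: "(\<lambda>p. norm (fst p - snd p)) \<in> borel_measurable (\<mu> \<Otimes>\<^sub>M \<mu>)"
    and \<phi>[measurable]: "case_prod \<phi> \<in> borel \<Otimes>\<^sub>M \<mu> \<rightarrow>\<^sub>M borel"
    and st: "stationary_distribution (\<lambda>x. distr \<mu> borel (\<phi> x)) \<pi>"
    and st': "stationary_distribution (\<lambda>x. distr \<nu> borel (\<phi> x)) \<pi>'"
    and R[measurable]: "(R :: 'z \<Rightarrow> ennreal) \<in> borel_measurable \<mu>"
    and \<delta>: "(\<integral>\<^sup>+z. R z \<partial>\<mu>) = ennreal \<delta>" "0 \<le> \<delta>" "\<delta> < 1"
    and lip: "\<And>x y z. z \<in> space \<mu> \<Longrightarrow> ennreal (norm (\<phi> x z - \<phi> y z)) \<le> R z * norm (x - y)"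
    and fin: "(\<integral>\<^sup>+z. norm (\<phi> a z - a) \<partial>\<mu>) < \<infinity>"
    and c: "0 < c"
      "\<And>x z z'. z \<in> space \<mu> \<Longrightarrow> z' \<in> space \<mu> \<Longrightarrow>
         norm (\<phi> x z - \<phi> x z') \<le> c * (norm x + 1) * norm (z - z')"
  shows "W1 \<pi> \<pi>' \<le> ((\<integral>\<^sup>+y. norm y \<partial>\<pi>') + 1) * ennreal (c / (1 - \<delta>)) * W1 \<mu> \<nu>"
proof -
  interpret \<mu>: prob_space \<mu> by fact
  interpret \<nu>: prob_space \<nu> by fact
  interpret \<pi>: prob_space \<pi> using st by (simp add: stationary_distribution_def)
  interpret \<pi>': prob_space \<pi>' using st' by (simp add: stationary_distribution_def)
  have s\<pi>[measurable_cong]: "sets \<pi> = sets borel" "sets \<pi>' = sets borel"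
    using st st' by (auto simp: stationary_distribution_def)
  have [measurable]: "\<phi> x \<in> \<mu> \<rightarrow>\<^sub>M borel" "\<phi> x \<in> \<nu> \<rightarrow>\<^sub>M borel" for x
    using measurable_compose[OF measurable_Pair1' \<phi>, of x] by (simp_all cong: measurable_cong_sets)
  have \<phi>'[measurable]: "case_prod \<phi> \<in> borel \<Otimes>\<^sub>M \<nu> \<rightarrow>\<^sub>M borel"
    using \<phi> by (simp cong: measurable_cong_sets)
  have ne: "couplings \<mu> \<nu> \<noteq> {}" "couplings \<pi> \<pi>' \<noteq> {}"
    using pair_measure_couplings \<mu>.prob_space_axioms \<nu>.prob_space_axioms
      \<pi>.prob_space_axioms \<pi>'.prob_space_axioms by blast+
  have sp: "space \<nu> = space \<mu>" using sets_eq_imp_space_eq[OF s\<nu>] .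
  define b where "b = enn2real (\<integral>\<^sup>+z. norm (\<phi> a z - a) \<partial>\<mu>)"
  have b: "(\<integral>\<^sup>+z. norm (\<phi> a z - a) \<partial>\<mu>) = ennreal b" "0 \<le> b"
    using fin by (simp_all add: b_def)
  have drift: "(\<integral>\<^sup>+z. norm (\<phi> x z - a) \<partial>\<mu>) \<le> ennreal (\<delta> * norm (x - a) + b)" for x
  proof -
    have "(\<integral>\<^sup>+z. norm (\<phi> x z - a) \<partial>\<mu>) \<le> (\<integral>\<^sup>+z. R z * norm (x - a) + norm (\<phi> a z - a) \<partial>\<mu>)"
    proof (rule nn_integral_mono)
      fix z assume z: "z \<in> space \<mu>"
      have "ennreal (norm (\<phi> x z - a)) \<le> ennreal (norm (\<phi> x z - \<phi> a z)) + ennreal (norm (\<phi> a z - a))"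
        using norm_triangle_ineq[of "\<phi> x z - \<phi> a z" "\<phi> a z - a"] by (simp flip: ennreal_plus)
      also have "\<dots> \<le> R z * norm (x - a) + norm (\<phi> a z - a)"
        using lip[OF z] by (intro add_right_mono)
      finally show "ennreal (norm (\<phi> x z - a)) \<le> R z * norm (x - a) + norm (\<phi> a z - a)" .
    qed
    also have "\<dots> = ennreal (\<delta> * norm (x - a) + b)"
      using \<delta> b by (simp add: nn_integral_add nn_integral_multc ennreal_mult)
    finally show ?thesis .
  qed
  have m: "(\<integral>\<^sup>+x. norm (x - a) \<partial>\<pi>) < \<infinity>"
    using stationary_moment_finite[OF assms(1) \<phi> st \<delta>(2,3) b(2) drift] .
  show ?thesis
  \<comment> \<open>In the first case the right-hand side is \<infinity>, as
    \<open>c / (1 - \<delta>)\<close> is positive. The condition on \<open>W1 \<mu> \<nu>\<close>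
    matters there, because \<open>\<infinity> * 0 = 0\<close> in \<open>ennreal\<close>.\<close>
  proof (cases "(\<integral>\<^sup>+y. norm y \<partial>\<pi>') = \<infinity> \<and> W1 \<mu> \<nu> \<noteq> 0")
    case True
    then have "((\<integral>\<^sup>+y. norm y \<partial>\<pi>') + 1) * ennreal (c / (1 - \<delta>)) * W1 \<mu> \<nu> = \<infinity>"
      using c \<delta> by (simp add: ennreal_top_mult ennreal_mult_eq_top_iff)
    then show ?thesis by simp
  next
    case False
    have m': "(\<integral>\<^sup>+y. norm (y - a) \<partial>\<pi>') < \<infinity>"
    proof (cases "W1 \<mu> \<nu> = 0")
      case True
      have "(\<integral>\<^sup>+z. norm (\<phi> x z - a) \<partial>\<nu>) \<le> ennreal (\<delta> * norm (x - a) + b)" for x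
      proof -
        \<comment> \<open>Along a coupling \<open>\<gamma>\<close> the datum of law
          \<open>\<nu>\<close> is replaced by one of law \<open>\<mu>\<close>, at a price
          proportional to the transport cost. The infimum over \<open>\<gamma>\<close> makes this
          price 0, so the drift keeps the same constants.\<close>
        have "(\<integral>\<^sup>+z. norm (\<phi> x z - a) \<partial>\<nu>) \<le> (\<integral>\<^sup>+z. norm (\<phi> x z - a) \<partial>\<mu>)
          + ennreal (c * (norm x + 1)) * (\<integral>\<^sup>+(z, z'). ennreal (norm (z - z')) \<partial>\<gamma>)"
          if \<gamma>: "\<gamma> \<in> couplings \<mu> \<nu>" for \<gamma>
        proof -
          have s\<gamma>[measurable_cong]: "sets \<gamma> = sets (\<mu> \<Otimes>\<^sub>M \<nu>)"
            using \<gamma> by (auto simp: couplings_def)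
          have sg: "space \<gamma> = space \<mu> \<times> space \<mu>"
            using sets_eq_imp_space_eq[OF s\<gamma>] sp by (simp add: space_pair_measure)
          have "(\<integral>\<^sup>+z. norm (\<phi> x z - a) \<partial>\<nu>) = (\<integral>\<^sup>+q. norm (\<phi> x (snd q) - a) \<partial>\<gamma>)"
            by (rule nn_integral_coupling_snd[OF \<gamma>, symmetric]) auto
          also have "\<dots> \<le> (\<integral>\<^sup>+q. ennreal (norm (\<phi> x (fst q) - a)) + ennreal (c * (norm x + 1)) * norm (fst q - snd q) \<partial>\<gamma>)"
          proof (rule nn_integral_mono)
            fix q assume "q \<in> space \<gamma>"
            then have "norm (\<phi> x (fst q) - \<phi> x (snd q)) \<le> c * (norm x + 1) * norm (fst q - snd q)"
              by (intro c) (auto simp: sg)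
            then have "norm (\<phi> x (snd q) - a) \<le> norm (\<phi> x (fst q) - a) + c * (norm x + 1) * norm (fst q - snd q)"
              using norm_triangle_ineq[of "\<phi> x (snd q) - \<phi> x (fst q)" "\<phi> x (fst q) - a"]
              by (simp add: norm_minus_commute)
            then show "ennreal (norm (\<phi> x (snd q) - a)) \<le> ennreal (norm (\<phi> x (fst q) - a)) + ennreal (c * (norm x + 1)) * norm (fst q - snd q)"
              using c(1) by (simp flip: ennreal_plus ennreal_mult)
          qed
          also have "\<dots> = (\<integral>\<^sup>+z. norm (\<phi> x z - a) \<partial>\<mu>)
            + ennreal (c * (norm x + 1)) * (\<integral>\<^sup>+q. norm (fst q - snd q) \<partial>\<gamma>)"
            using nn_integral_coupling_fst[OF \<gamma>, of "\<lambda>z. norm (\<phi> x z - a)"]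
            by (simp add: nn_integral_add nn_integral_cmult)
          finally show ?thesis by (simp add: case_prod_unfold)
        qed
        then have "(\<integral>\<^sup>+z. norm (\<phi> x z - a) \<partial>\<nu>) \<le> (\<integral>\<^sup>+z. norm (\<phi> x z - a) \<partial>\<mu>)
          + ennreal (c * (norm x + 1)) * W1 \<mu> \<nu>"
          unfolding W1_def by (intro le_add_mult_INF_ennreal ne) auto
        then show ?thesis using drift[of x] True by simp
      qed
      then show ?thesis
        by (rule stationary_moment_finite[OF assms(2) \<phi>' st' \<delta>(2,3) b(2)])
    next
      case False
      with \<open>\<not> (_ \<and> _)\<close> have "(\<integral>\<^sup>+y. norm y \<partial>\<pi>') < \<infinity>" by (simp add: top.not_eq_extremum)
      moreover have "(\<integral>\<^sup>+y. norm (y - a) \<partial>\<pi>') \<le> (\<integral>\<^sup>+y. ennreal (norm y) + ennreal (norm a) \<partial>\<pi>')"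
        by (intro nn_integral_mono) (simp add: norm_triangle_ineq4 flip: ennreal_plus)
      ultimately show ?thesis
        by (simp add: nn_integral_add \<pi>'.emeasure_space_1 order_le_less_trans)
    qed
    \<comment> \<open>The moment is moved from \<open>a\<close> to the origin, since the noise bound
      is weighted by \<open>norm y\<close>.\<close>
    have "(\<integral>\<^sup>+y. norm y \<partial>\<pi>') \<le> (\<integral>\<^sup>+y. ennreal (norm (y - a)) + ennreal (norm a) \<partial>\<pi>')"
      by (intro nn_integral_mono) (simp add: norm_triangle_sub add.commute flip: ennreal_plus)
    then have E: "(\<integral>\<^sup>+y. norm y \<partial>\<pi>') < \<infinity>"
      using m' by (simp add: nn_integral_add \<pi>'.emeasure_space_1 order_le_less_trans)
    have W: "W1 \<pi> \<pi>' < \<infinity>"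
      using W1_le_moments[OF \<pi>.prob_space_axioms \<pi>'.prob_space_axioms s\<pi>, of a a] m m'
      by (simp add: order_le_less_trans)
    let ?k = "ennreal c * ((\<integral>\<^sup>+y. norm y \<partial>\<pi>') + 1)"
    have k: "?k < top" using E by (simp add: ennreal_mult_less_top)
    \<comment> \<open>The infimum is taken over \<open>\<gamma>\<close> first, with
      \<open>\<Gamma>\<close> fixed, and afterwards over \<open>\<Gamma>\<close>; the factors
      \<open>?k\<close> and \<open>\<delta>\<close> in front of the two infima are finite.\<close>
    have "W1 \<pi> \<pi>' \<le> ennreal \<delta> * (\<integral>\<^sup>+(x, y). ennreal (norm (x - y)) \<partial>\<Gamma>) + ?k * W1 \<mu> \<nu>"
      if "\<Gamma> \<in> couplings \<pi> \<pi>'" for \<Gamma>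
      unfolding W1_def[of \<mu>]
      by (intro le_add_mult_INF_ennreal ne k
        W1_stationary_le_coupling[OF assms(1-4) \<phi> st st' R lip less_imp_le[OF c(1)] c(2) that, unfolded \<delta>(1)])
    then have "W1 \<pi> \<pi>' \<le> ?k * W1 \<mu> \<nu> + ennreal \<delta> * W1 \<pi> \<pi>'"
      unfolding W1_def[of \<pi>] by (intro le_add_mult_INF_ennreal ne) (simp_all add: add.commute)
    then have "ennreal (1 - \<delta>) * W1 \<pi> \<pi>' \<le> ?k * W1 \<mu> \<nu>"
    proof -
      \<comment> \<open>Splitting \<open>W1 \<pi> \<pi>'\<close> with weights
        \<open>\<delta>\<close> and \<open>1 - \<delta>\<close> replaces a subtraction; the common
        summand may be cancelled because it is finite by \<open>W\<close>.\<close>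
      have "ennreal \<delta> * W1 \<pi> \<pi>' + ennreal (1 - \<delta>) * W1 \<pi> \<pi>' = W1 \<pi> \<pi>'"
        using \<delta> by (simp flip: distrib_right ennreal_plus)
      also have "\<dots> \<le> ennreal \<delta> * W1 \<pi> \<pi>' + ?k * W1 \<mu> \<nu>"
        using \<open>W1 \<pi> \<pi>' \<le> _\<close> by (simp add: add.commute)
      finally show ?thesis
        using W by (auto simp: ennreal_add_left_cancel_le ennreal_mult_eq_top_iff)
    qed
    then have "ennreal (1 / (1 - \<delta>)) * (ennreal (1 - \<delta>) * W1 \<pi> \<pi>') \<le> ennreal (1 / (1 - \<delta>)) * (?k * W1 \<mu> \<nu>)"
      by (rule mult_left_mono) simp
    moreover have "ennreal (1 / (1 - \<delta>)) * (ennreal (1 - \<delta>) * W1 \<pi> \<pi>') = W1 \<pi> \<pi>'"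
      using \<delta> by (simp flip: mult.assoc ennreal_mult)
    moreover have "ennreal (1 / (1 - \<delta>)) * (?k * W1 \<mu> \<nu>) = ((\<integral>\<^sup>+y. norm y \<partial>\<pi>') + 1) * ennreal (c / (1 - \<delta>)) * W1 \<mu> \<nu>"
      using \<delta> c(1) by (simp add: divide_inverse ennreal_mult mult_ac)
    ultimately show ?thesis by simp
  qed
qed

section \<open>Lipschitz constants and derivatives of the SGD step\<close>

text \<open>The difference quotients along the line \<open>x + t *\<^sub>R v\<close> are bounded by
  \<open>K * norm v\<close>, hence so is their limit \<open>D v\<close>.\<close>

lemma onorm_derivative_le:
  fixes g :: "'a::{real_normed_vector, perfect_space} \<Rightarrow> 'b::real_normed_vector"
  assumes g: "(g has_derivative D) (at x)"
    and K: "\<And>y. norm (g y - g x) \<le> K * norm (y - x)"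
  shows "onorm D \<le> K"
proof (rule onorm_le)
  fix v
  interpret D: bounded_linear D using g by (rule has_derivative_bounded_linear)
  have "((\<lambda>t::real. g (x + t *\<^sub>R v)) has_derivative (\<lambda>t. D (t *\<^sub>R v))) (at 0)"
  proof (rule has_derivative_compose[of "\<lambda>t. x + t *\<^sub>R v" "\<lambda>t. t *\<^sub>R v" 0 UNIV g D])
    show "((\<lambda>t::real. x + t *\<^sub>R v) has_derivative (\<lambda>t. t *\<^sub>R v)) (at 0)"
      by (auto intro!: derivative_eq_intros)
    show "(g has_derivative D) (at (x + 0 *\<^sub>R v))"
      using g by simp
  qed
  then have "((\<lambda>t. norm (g (x + t *\<^sub>R v) - g x - t *\<^sub>R D v) / \<bar>t\<bar>) \<longlongrightarrow> 0) (at 0)"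
    by (simp add: has_derivative_iff_norm D.scaleR)
  moreover have "\<forall>\<^sub>F t in at 0. norm (g (x + t *\<^sub>R v) - g x - t *\<^sub>R D v) / \<bar>t\<bar> = norm ((g (x + t *\<^sub>R v) - g x) /\<^sub>R t - D v)"
    unfolding eventually_at_filter
  proof (rule always_eventually, intro allI impI)
    fix t :: real assume t: "t \<noteq> 0"
    have "norm (g (x + t *\<^sub>R v) - g x - t *\<^sub>R D v) = norm (t *\<^sub>R ((g (x + t *\<^sub>R v) - g x) /\<^sub>R t - D v))"
      using t by (simp add: scaleR_right_diff_distrib)
    then show "norm (g (x + t *\<^sub>R v) - g x - t *\<^sub>R D v) / \<bar>t\<bar> = norm ((g (x + t *\<^sub>R v) - g x) /\<^sub>R t - D v)"
      using t by simp
  qed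
  ultimately have "((\<lambda>t. norm ((g (x + t *\<^sub>R v) - g x) /\<^sub>R t - D v)) \<longlongrightarrow> 0) (at 0)"
    by (rule Lim_transform_eventually)
  then have "((\<lambda>t. (g (x + t *\<^sub>R v) - g x) /\<^sub>R t) \<longlongrightarrow> D v) (at 0)"
    by (rule LIM_zero_cancel[OF tendsto_norm_zero_cancel])
  then have lim: "((\<lambda>t. norm ((g (x + t *\<^sub>R v) - g x) /\<^sub>R t)) \<longlongrightarrow> norm (D v)) (at 0)"
    by (rule tendsto_norm)
  show "norm (D v) \<le> K * norm v"
  proof (rule tendsto_upperbound[OF lim])
    have "norm ((g (x + t *\<^sub>R v) - g x) /\<^sub>R t) \<le> K * norm v" if "t \<noteq> 0" for t :: real
    proof -
      have "norm (g (x + t *\<^sub>R v) - g x) \<le> (K * norm v) * \<bar>t\<bar>"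
        using K[of "x + t *\<^sub>R v"] by (simp add: mult_ac)
      then show ?thesis
        using that by (simp add: pos_divide_le_eq divide_inverse[symmetric] mult.commute[of "inverse _"])
    qed
    then show "\<forall>\<^sub>F t in at 0. norm ((g (x + t *\<^sub>R v) - g x) /\<^sub>R t) \<le> K * norm v"
      by (auto simp: eventually_at_filter)
  qed simp
qed

text \<open>This is the mean value inequality. In \<open>ennreal\<close> it also covers an infinite
  supremum, where the case \<open>x = y\<close> is consistent with
  \<open>\<infinity> * 0 = 0\<close>.\<close>

lemma norm_diff_le_SUP_onorm:
  fixes g :: "'a::real_normed_vector \<Rightarrow> 'b::real_normed_vector"
  assumes "\<And>x. (g has_derivative D x) (at x)"
  shows "ennreal (norm (g x - g y)) \<le> (SUP x. ennreal (onorm (D x))) * norm (x - y)"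
proof (cases "(SUP x. ennreal (onorm (D x)))" rule: ennreal_cases)
  case (real s)
  have "onorm (D x) \<le> s" for x
  proof -
    have "ennreal (onorm (D x)) \<le> (SUP x. ennreal (onorm (D x)))"
      by (rule SUP_upper) simp
    then have "ennreal (onorm (D x)) \<le> ennreal s"
      unfolding real(2) .
    then show ?thesis using real(1) by (simp only: ennreal_le_iff)
  qed
  then have "norm (g x - g y) \<le> s * norm (x - y)"
    using assms by (intro differentiable_bound[of UNIV g D]) auto
  then have "ennreal (norm (g x - g y)) \<le> ennreal s * ennreal (norm (x - y))"
    using real(1) by (simp flip: ennreal_mult)
  then show ?thesis unfolding real(2) .
next
  case top
  show ?thesis unfolding top by (cases "x = y") (simp_all add: ennreal_top_mult)
qed

text \<open>The quotients involve values of \<open>g\<close> alone. For the SGD step these depend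
  continuously on the datum, whereas nothing of the kind is assumed about the Hessian, so
  measurability of \<open>R_fun\<close> is read off from this form. Pairs with \<open>x = y\<close>
  contribute 0, since division by 0 gives 0.\<close>

lemma SUP_onorm_eq_SUP_quotient:
  fixes g :: "'a::{real_normed_vector, perfect_space} \<Rightarrow> 'b::real_normed_vector"
  assumes g: "\<And>x. (g has_derivative D x) (at x)"
  shows "(SUP x. ennreal (onorm (D x))) = (SUP (x, y). ennreal (norm (g x - g y) / norm (x - y)))"
    (is "?S = ?Q")
proof (rule antisym)
  have q: "ennreal (norm (g x - g y) / norm (x - y)) \<le> ?Q" for x y
    by (rule SUP_upper2[of "(x, y)"]) auto
  show "?S \<le> ?Q"
  proof (cases ?Q rule: ennreal_cases)
    case (real s)
    show ?thesis
    proof (rule SUP_least)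
      fix x
      have "norm (g y - g x) \<le> s * norm (y - x)" for y
      proof (cases "y = x")
        case False
        have "ennreal (norm (g y - g x) / norm (y - x)) \<le> ennreal s"
          using q[of y x] unfolding real(2) .
        then have "norm (g y - g x) / norm (y - x) \<le> s"
          using real(1) by (simp only: ennreal_le_iff)
        then show ?thesis using False by (simp add: pos_divide_le_eq)
      qed simp
      then have "onorm (D x) \<le> s"
        by (rule onorm_derivative_le[OF g])
      then show "ennreal (onorm (D x)) \<le> ?Q"
        unfolding real(2) by (rule ennreal_leI)
    qed
  next
    case top
    show ?thesis unfolding top by simp
  qed
  show "?Q \<le> ?S"
  proof (rule SUP_least, clarify)
    fix x y
    show "ennreal (norm (g x - g y) / norm (x - y)) \<le> ?S"
    proof (cases "x = y")
      case False
      then have "ennreal (norm (g x - g y) / norm (x - y)) = ennreal (norm (g x - g y)) * ennreal (inverse (norm (x - y)))"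
        by (simp add: divide_inverse ennreal_mult)
      also have "\<dots> \<le> (?S * norm (x - y)) * ennreal (inverse (norm (x - y)))"
        by (intro mult_right_mono norm_diff_le_SUP_onorm g) simp
      also have "\<dots> = ?S"
        using False by (simp add: mult.assoc flip: ennreal_mult)
      finally show ?thesis .
    qed simp
  qed
qed

lemma sgd_step_has_derivative:
  assumes "twice_differentiable (\<lambda>x. f x z)"
  shows "((\<lambda>x. sgd_step \<eta> f x z) has_derivative
    (\<lambda>v. (mat 1 - \<eta> *\<^sub>R hessian (\<lambda>x. f x z) x) *v v)) (at x)"
proof -
  let ?D = "frechet_derivative (grad (\<lambda>x. f x z)) (at x)"
  have D: "(grad (\<lambda>x. f x z) has_derivative ?D) (at x)"
    using assms by (simp add: twice_differentiable_def flip: frechet_derivative_works)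
  then have "linear ?D" by (rule has_derivative_linear)
  then have "hessian (\<lambda>x. f x z) x *v v = ?D v" for v
    by (simp add: hessian_def matrix_works)
  then have "(\<lambda>v. (mat 1 - \<eta> *\<^sub>R hessian (\<lambda>x. f x z) x) *v v) = (\<lambda>v. v - \<eta> *\<^sub>R ?D v)"
    by (simp add: matrix_vector_mult_diff_rdistrib flip: scaleR_matrix_vector_assoc)
  then show ?thesis
    unfolding sgd_step_def using D by (auto intro!: derivative_eq_intros)
qed

lemma sgd_step_lipschitz:
  assumes "twice_differentiable (\<lambda>x. f x z)"
  shows "ennreal (norm (sgd_step \<eta> f x z - sgd_step \<eta> f y z)) \<le> R_fun \<eta> f z * norm (x - y)"
  unfolding R_fun_def spectral_norm_def
  by (rule norm_diff_le_SUP_onorm[OF sgd_step_has_derivative[of f z, OF assms]])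

lemma R_fun_eq_SUP_quotient:
  assumes "twice_differentiable (\<lambda>x. f x z)"
  shows "R_fun \<eta> f z =
    (SUP (x, y). ennreal (norm (sgd_step \<eta> f x z - sgd_step \<eta> f y z) / norm (x - y)))"
  unfolding R_fun_def spectral_norm_def
  by (rule SUP_onorm_eq_SUP_quotient[OF sgd_step_has_derivative[of f z, OF assms]])

text \<open>The index set may be uncountable: the supremum is lower semicontinuous.\<close>

lemma borel_measurable_SUP_continuous:
  fixes q :: "'i \<Rightarrow> 'z::topological_space \<Rightarrow> ennreal"
  assumes "S \<in> sets borel" "\<And>i. i \<in> I \<Longrightarrow> continuous_on S (q i)"
  shows "(\<lambda>z. SUP i\<in>I. q i z) \<in> borel_measurable (restrict_space borel S)"
proof (rule borel_measurableI_greater)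
  fix a
  have "openin (top_of_set S) {z \<in> S. a < q i z}" if "i \<in> I" for i
    using continuous_openin_preimage_gen[OF assms(2)[OF that] open_greaterThan[of a]]
    by (simp add: vimage_def Int_def)
  then have "openin (top_of_set S) (\<Union>i\<in>I. {z \<in> S. a < q i z})"
    by (intro openin_Union) auto
  then obtain U where U: "open U" "(\<Union>i\<in>I. {z \<in> S. a < q i z}) = S \<inter> U"
    by (auto simp: openin_open)
  have "{z \<in> space (restrict_space borel S). a < (SUP i\<in>I. q i z)} = (\<Union>i\<in>I. {z \<in> S. a < q i z})"
    by (auto simp: less_SUP_iff space_restrict_space)
  then show "{z \<in> space (restrict_space borel S). a < (SUP i\<in>I. q i z)} \<in> sets (restrict_space borel S)"
    using U assms(1) by (simp add: sets_restrict_space_iff)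
qed

section \<open>The mean contraction factor\<close>

text \<open>The graph of \<open>y powr \<beta>\<close> lies above its tangent at 1 and touches it
  only there. Integrating the gap, with the mean of the power equal to 1, forces the mean of
  \<open>g\<close> below 1.\<close>

lemma mean_lt_one_of_powr_mean_eq_one:
  assumes "prob_space \<mu>" and g[measurable]: "g \<in> borel_measurable \<mu>" and g0: "\<And>x. 0 \<le> g x"
    and int: "(\<integral>\<^sup>+x. ennreal (g x) \<partial>\<mu>) < \<infinity>"
    and \<beta>: "1 < \<beta>" "(\<integral>\<^sup>+x. ennreal (g x powr \<beta>) \<partial>\<mu>) = 1"
    and ne: "\<not> (AE x in \<mu>. g x = 1)"
  shows "(\<integral>\<^sup>+x. ennreal (g x) \<partial>\<mu>) < 1"
proof -
  interpret prob_space \<mu> by fact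
  have ib: "integrable \<mu> (\<lambda>x. g x powr \<beta>)" and vb: "(\<integral>x. g x powr \<beta> \<partial>\<mu>) = 1"
    using \<beta> by (auto intro!: integrableI_nonneg simp: integral_eq_nn_integral)
  have ig: "integrable \<mu> g"
    using int g0 by (intro integrableI_nonneg) auto
  have tangent: "0 < y powr \<beta> - 1 - \<beta> * (y - 1)" if "0 \<le> y" "y \<noteq> 1" for y
  proof -
    \<comment> \<open>The derivative of this \<open>h\<close> has the sign of \<open>y - 1\<close>
      at positive \<open>y\<close>, so 1 is a strict minimum; the claim is \<open>h 1 < h y\<close>
      rearranged.\<close>
    define h where "h y = y powr \<beta> - \<beta> * y" for y
    have h': "DERIV h x :> \<beta> * (x powr (\<beta> - 1) - 1)" if "0 < x" for x
      unfolding h_def using that by (auto intro!: derivative_eq_intros simp: algebra_simps)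
    have p: "x powr (\<beta> - 1) < 1" if "0 \<le> x" "x < 1" for x
      using that \<beta>(1) powr_less_mono2[of "\<beta> - 1" x 1] by simp
    have p': "1 < x powr (\<beta> - 1)" if "1 < x" for x
      using that \<beta>(1) powr_less_mono2[of "\<beta> - 1" 1 x] by simp
    \<comment> \<open>The derivative \<open>h'\<close> is stated at positive arguments only, so 0 is
      treated apart: there \<open>h 0 = 0\<close>, while \<open>h 1 = 1 - \<beta>\<close> is
      negative.\<close>
    have "y = 0 \<or> 0 < y \<and> y < 1 \<or> 1 < y" using that by linarith
    then consider "y = 0" | "0 < y" "y < 1" | "1 < y" by blast
    then have "h 1 < h y"
    proof cases
      case 1
      then show ?thesis using \<beta>(1) by (simp add: h_def)
    next
      case 2
      then obtain x where x: "y < x" "x < 1" "h 1 - h y = (1 - y) * (\<beta> * (x powr (\<beta> - 1) - 1))"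
        using MVT2[of y 1 h "\<lambda>x. \<beta> * (x powr (\<beta> - 1) - 1)"] h' by auto
      have "(1 - y) * (\<beta> * (x powr (\<beta> - 1) - 1)) < 0"
        using 2 x(1,2) \<beta>(1) p[of x] by (intro mult_pos_neg) simp_all
      then show ?thesis using x(3) by linarith
    next
      case 3
      then obtain x where x: "1 < x" "x < y" "h y - h 1 = (y - 1) * (\<beta> * (x powr (\<beta> - 1) - 1))"
        using MVT2[of 1 y h "\<lambda>x. \<beta> * (x powr (\<beta> - 1) - 1)"] h' by auto
      have "0 < (y - 1) * (\<beta> * (x powr (\<beta> - 1) - 1))"
        using 3 x(1,2) \<beta>(1) p'[of x] by (intro mult_pos_pos) simp_all
      then show ?thesis using x(3) by linarith
    qed
    then show ?thesis by (simp add: h_def algebra_simps)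
  qed
  \<comment> \<open>From here on \<open>h\<close> is the gap to the tangent, evaluated at
    \<open>g x\<close>. Its integral is \<open>\<beta>\<close> times one minus the mean of
    \<open>g\<close>, and it is nonzero because a vanishing integral would give
    \<open>g x = 1\<close> almost everywhere.\<close>
  define h where "h x = g x powr \<beta> - 1 - \<beta> * (g x - 1)" for x
  have h_pos: "0 < h x" if "g x \<noteq> 1" for x
    unfolding h_def by (rule tangent[OF g0 that])
  have h_zero: "h x = 0" if "g x = 1" for x
    using that by (simp add: h_def)
  have h0: "0 \<le> h x" and h1: "h x = 0 \<longleftrightarrow> g x = 1" for x
    using h_pos[of x] h_zero[of x] by fastforce+
  have ih: "integrable \<mu> h" unfolding h_def using ib ig by simp
  have "(\<integral>x. h x \<partial>\<mu>) \<noteq> 0"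
    using integral_nonneg_eq_0_iff_AE[OF ih] h0 h1 ne by simp
  moreover have "0 \<le> (\<integral>x. h x \<partial>\<mu>)" using h0 by simp
  moreover have "(\<integral>x. h x \<partial>\<mu>) = \<beta> * (1 - (\<integral>x. g x \<partial>\<mu>))"
    unfolding h_def using ib ig vb by (simp add: prob_space algebra_simps)
  ultimately have "0 < \<beta> * (1 - (\<integral>x. g x \<partial>\<mu>))" by linarith
  then have "(\<integral>x. g x \<partial>\<mu>) < 1"
    using \<beta>(1) by (simp add: zero_less_mult_iff)
  then show ?thesis
    using nn_integral_eq_integral[OF ig] g0 by (simp add: ennreal_less_one_iff)
qed

section \<open>Joint continuity and measurability\<close>

text \<open>Near \<open>x0\<close> the Lipschitz constant \<open>c * (norm x + 1)\<close> in the
  second variable stays bounded, so comparison through \<open>g x z0\<close> leaves only the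
  continuity in \<open>x\<close>.\<close>

lemma continuous_on_prod_of_separately_continuous:
  fixes g :: "'a::real_normed_vector \<Rightarrow> 'z::real_normed_vector \<Rightarrow> 'b::real_normed_vector"
  assumes g: "\<And>z. z \<in> S \<Longrightarrow> continuous_on UNIV (\<lambda>x. g x z)"
    and c: "\<And>x z z'. z \<in> S \<Longrightarrow> z' \<in> S \<Longrightarrow> norm (g x z - g x z') \<le> c * (norm x + 1) * norm (z - z')"
  shows "continuous_on (UNIV \<times> S) (case_prod g)"
  unfolding continuous_on_def
proof clarify
  fix x0 :: 'a and z0 :: 'z assume z0: "z0 \<in> S"
  let ?F = "at (x0, z0) within UNIV \<times> S"
  have fst: "((\<lambda>p. fst p) \<longlongrightarrow> x0) ?F" and snd: "((\<lambda>p. snd p) \<longlongrightarrow> z0) ?F"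
    using tendsto_fst[OF tendsto_ident_at] tendsto_snd[OF tendsto_ident_at] by fastforce+
  have "((\<lambda>x. g x z0) \<longlongrightarrow> g x0 z0) (at x0)"
    using g[OF z0] by (simp add: continuous_on_def)
  then have gx: "((\<lambda>p. g (fst p) z0) \<longlongrightarrow> g x0 z0) ?F"
    by (rule tendsto_compose[OF _ fst])
  have "((\<lambda>p. norm (g (fst p) z0 - g x0 z0) + c * (norm (fst p) + 1) * norm (snd p - z0)) \<longlongrightarrow>
      norm (g x0 z0 - g x0 z0) + c * (norm x0 + 1) * norm (z0 - z0)) ?F"
    by (intro tendsto_intros gx fst snd)
  then have lim: "((\<lambda>p. norm (g (fst p) z0 - g x0 z0) + c * (norm (fst p) + 1) * norm (snd p - z0)) \<longlongrightarrow> 0) ?F"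
    by simp
  have "norm (case_prod g p - g x0 z0) \<le> norm (g (fst p) z0 - g x0 z0) + c * (norm (fst p) + 1) * norm (snd p - z0)"
    if "p \<in> UNIV \<times> S" for p
    using c[of "snd p" z0 "fst p"] that z0
      norm_triangle_ineq[of "case_prod g p - g (fst p) z0" "g (fst p) z0 - g x0 z0"]
    by (auto simp: case_prod_unfold)
  then have "\<forall>\<^sub>F p in ?F. norm (case_prod g p - g x0 z0)
      \<le> norm (g (fst p) z0 - g x0 z0) + c * (norm (fst p) + 1) * norm (snd p - z0)"
    by (simp add: eventually_at_filter)
  then have "((\<lambda>p. case_prod g p - g x0 z0) \<longlongrightarrow> 0) ?F"
    using lim by (rule Lim_null_comparison)
  then show "(case_prod g \<longlongrightarrow> g x0 z0) ?F"
    by (rule LIM_zero_cancel)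
qed

text \<open>The extension of \<open>g\<close> by 0 outside the Borel set
  \<open>UNIV \<times> S\<close> is Borel measurable, and by second countability the Borel sets of
  the product space form the product \<sigma>-algebra. On the restricted space the extension agrees
  with \<open>g\<close>.\<close>

lemma measurable_restrict_pair_of_continuous_on:
  fixes g :: "'a::second_countable_topology \<Rightarrow> 'z::second_countable_topology \<Rightarrow> 'b::real_normed_vector"
  assumes S: "S \<in> sets borel" and g: "continuous_on (UNIV \<times> S) (case_prod g)"
  shows "case_prod g \<in> borel \<Otimes>\<^sub>M restrict_space borel S \<rightarrow>\<^sub>M borel"
proof -
  have "UNIV \<times> S \<in> sets ((borel :: 'a measure) \<Otimes>\<^sub>M borel)" using S by auto
  then have "(UNIV :: 'a set) \<times> S \<in> sets borel" unfolding borel_prod .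
  then have "(\<lambda>p. indicator (UNIV \<times> S) p *\<^sub>R case_prod g p) \<in> borel \<rightarrow>\<^sub>M borel"
    using g by (rule borel_measurable_continuous_on_indicator)
  then have 1: "(\<lambda>p. indicator (UNIV \<times> S) p *\<^sub>R case_prod g p) \<in> borel \<Otimes>\<^sub>M borel \<rightarrow>\<^sub>M borel"
    by (simp add: borel_prod)
  have 2: "(\<lambda>p. (fst p, snd p)) \<in> (borel :: 'a measure) \<Otimes>\<^sub>M restrict_space (borel :: 'z measure) S \<rightarrow>\<^sub>M borel \<Otimes>\<^sub>M borel"
    by (intro measurable_Pair measurable_fst measurable_compose[OF measurable_snd] measurable_restrict_space1) simp
  show ?thesis
    using measurable_compose[OF 2 1]
    by (rule measurable_cong[THEN iffD1, rotated]) (auto simp: space_pair_measure space_restrict_space)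
qed

section \<open>The bound for online and offline SGD\<close>

theorem theorem6:
  fixes \<eta> \<beta> L \<epsilon> :: real
    and Zs :: "(real^'m) set" and \<mu>z :: "(real^'m) measure"
    and f :: "real^'d \<Rightarrow> real^'m \<Rightarrow> real"
    and M :: "'w measure" and Z :: "nat \<Rightarrow> 'w \<Rightarrow> real^'m" and X :: "nat \<Rightarrow> 'w \<Rightarrow> real^'d"
    and \<pi> :: "(real^'d) measure"
    and n :: nat
    and N :: "(nat \<Rightarrow> real^'m) \<Rightarrow> 'v measure"
    and Zh :: "(nat \<Rightarrow> real^'m) \<Rightarrow> nat \<Rightarrow> 'v \<Rightarrow> real^'m"
    and Xn :: "(nat \<Rightarrow> real^'m) \<Rightarrow> nat \<Rightarrow> 'v \<Rightarrow> real^'d"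
  defines "R \<equiv> R_fun \<eta> f" and "r \<equiv> r_fun \<eta> f"
    and "dataset \<equiv> \<lambda>\<omega>. \<lambda>j\<in>{1..n}. Z j \<omega>"
    and "\<mu>n \<equiv> empirical_measure \<mu>z n"
    and "\<delta>R \<equiv> enn2real (\<integral>\<^sup>+\<omega>. R_fun \<eta> f (Z 1 \<omega>) \<partial>M)"
  assumes eta: "\<eta> > 0"
    and Zs: "Zs \<in> sets borel"
    and mu: "prob_space \<mu>z" "sets \<mu>z = sets (restrict_space borel Zs)"
    and f: "\<And>z. z \<in> Zs \<Longrightarrow> twice_differentiable (\<lambda>x. f x z)"
      "\<And>z. z \<in> Zs \<Longrightarrow> strongly_convex (\<lambda>x. f x z)"
    \<comment> \<open>online chain, driven by the stream \<open>Z 1, Z 2, \<dots>\<close>\<close>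
    and online: "sgd_chain M \<eta> f \<mu>z X Z"
    \<comment> \<open>offline chain, conditionally on each possible value \<open>D\<close> of the dataset\<close>
    and offline: "\<And>D. D \<in> {1..n} \<rightarrow>\<^sub>E Zs \<Longrightarrow> sgd_chain (N D) \<eta> f (\<mu>n D) (Xn D) (Zh D)"
    and i: "\<exists>xs. (\<integral>\<^sup>+\<omega>. R (Z 1 \<omega>) + ennreal (norm (grad (\<lambda>x. f x (Z 1 \<omega>)) xs)) \<partial>M) < \<infinity>"
      "expectation_ext M (\<lambda>\<omega>. log_ext (R (Z 1 \<omega>))) < 0"
      \<comment> \<open>\<open>outer_measure_of\<close> agrees with \<open>emeasure\<close> on measurable sets\<close>
      "outer_measure_of M {\<omega> \<in> space M. r (Z 1 \<omega>) > 1} > 0"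
    and ii: "L > 0"
      "\<And>x z z'. z \<in> Zs \<Longrightarrow> z' \<in> Zs \<Longrightarrow>
         norm (grad (\<lambda>x. f x z) x - grad (\<lambda>x. f x z') x) \<le> L * (norm x + 1) * norm (z - z')"
    and iii: "\<exists>q\<ge>1. (\<integral>\<^sup>+z. ennreal (norm z powr q) \<partial>\<mu>z) < \<infinity>"
    and iv: "\<not> (\<exists>c. AE \<omega> in M. R (Z 1 \<omega>) = c)"
    and v: "W1_geometrically_ergodic_to M X (sgd_kernel \<eta> f \<mu>z) \<pi>"
    \<comment> \<open>\<open>R (Z 1 \<omega>)\<close> is almost surely finite by the first assumption in \<open>i\<close>\<close>
    and beta: "\<beta> > 0" "(\<integral>\<^sup>+\<omega>. ennreal (enn2real (R (Z 1 \<omega>)) powr \<beta>) \<partial>M) = 1" "\<beta> > 1"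
    and n: "n \<ge> 1"
    and eps: "\<epsilon> = enn2real (outer_measure_of M {\<omega> \<in> space M.
        \<not> W1_ergodic (N (dataset \<omega>)) (Xn (dataset \<omega>)) (sgd_kernel \<eta> f (\<mu>n (dataset \<omega>)))})"
  shows "\<exists>A\<in>sets M. measure M A \<ge> 1 - \<epsilon> \<and>
    (\<forall>\<omega>\<in>A. let D = dataset \<omega>; K = sgd_kernel \<eta> f (\<mu>n D) in
       W1_ergodic (N D) (Xn D) K \<and>
       (\<forall>\<pi>n. W1_ergodic_to (N D) (Xn D) K \<pi>n \<longrightarrow>
          W1 \<pi> \<pi>n \<le> ((\<integral>\<^sup>+x. ennreal (norm x) \<partial>\<pi>n) + 1)
            * ennreal (L * (\<eta> / (1 - \<delta>R))) * W1 \<mu>z (\<mu>n D)))"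
proof -
  have sgd_online: "prob_space M" "prob_space.indep_vars M (\<lambda>_. \<mu>z) Z {1..}" "distr M \<mu>z (Z 1) = \<mu>z"
    using online by (auto simp: sgd_chain_def iid_def)
  interpret M: prob_space M by fact
  interpret \<mu>z: prob_space \<mu>z by fact
  note [measurable_cong] = mu(2)
  have sp: "space \<mu>z = Zs"
    using sets_eq_imp_space_eq[OF mu(2)] by (simp add: space_restrict_space)
  have Z[measurable]: "Z k \<in> M \<rightarrow>\<^sub>M \<mu>z" if "1 \<le> k" for k
    using sgd_online(2) that by (simp add: M.indep_vars_def)
  then have Z1[measurable]: "Z 1 \<in> M \<rightarrow>\<^sub>M \<mu>z" by simp
  \<comment> \<open>The hypotheses are expectations over \<open>M\<close>, while the lemmas above
    integrate over the law of one datum.\<close>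
  have int_Z1: "(\<integral>\<^sup>+z. g z \<partial>\<mu>z) = (\<integral>\<^sup>+\<omega>. g (Z 1 \<omega>) \<partial>M)" if "g \<in> borel_measurable \<mu>z" for g
    using nn_integral_distr[OF Z1, of g] that unfolding sgd_online(3) .

  let ?\<phi> = "sgd_step \<eta> f"
  have noise: "norm (?\<phi> x z - ?\<phi> x z') \<le> \<eta> * L * (norm x + 1) * norm (z - z')"
    if "z \<in> Zs" "z' \<in> Zs" for x z z'
  proof -
    have "?\<phi> x z - ?\<phi> x z' = \<eta> *\<^sub>R (grad (\<lambda>x. f x z') x - grad (\<lambda>x. f x z) x)"
      by (simp add: sgd_step_def algebra_simps)
    then show ?thesis
      using mult_left_mono[OF ii(2)[OF that(2,1), of x], of \<eta>] eta
      by (simp add: norm_minus_commute mult.assoc)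
  qed
  have "continuous_on UNIV (\<lambda>x. ?\<phi> x z)" if "z \<in> Zs" for z
    using sgd_step_has_derivative[of f z, OF f(1)[OF that]]
    by (intro has_derivative_continuous_on) auto
  then have cont: "continuous_on (UNIV \<times> Zs) (case_prod ?\<phi>)"
    using noise by (rule continuous_on_prod_of_separately_continuous)
  have \<phi>[measurable]: "case_prod ?\<phi> \<in> borel \<Otimes>\<^sub>M \<mu>z \<rightarrow>\<^sub>M borel"
    using measurable_restrict_pair_of_continuous_on[OF Zs cont] by (simp cong: measurable_cong_sets)
  have [measurable]: "?\<phi> x \<in> \<mu>z \<rightarrow>\<^sub>M borel" for x
    using measurable_compose[OF measurable_Pair1' \<phi>, of x] by simp
  have cont2: "continuous_on Zs (?\<phi> x)" for x
  proof -
    have "continuous_on Zs (\<lambda>z. case_prod ?\<phi> (x, z))"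
      by (rule continuous_on_compose2[OF cont]) (auto intro!: continuous_intros)
    then show ?thesis by simp
  qed
  \<comment> \<open>For \<open>x = y\<close> the factor \<open>inverse 0\<close> is 0, so the
    quotient is continuous in \<open>z\<close> for every pair.\<close>
  have "continuous_on Zs (\<lambda>z. norm (?\<phi> x z - ?\<phi> y z) / norm (x - y))" for x y
    unfolding divide_inverse
    by (intro continuous_on_mult continuous_on_norm continuous_on_diff continuous_on_const cont2)
  then have "(\<lambda>z. SUP (x, y). ennreal (norm (?\<phi> x z - ?\<phi> y z) / norm (x - y))) \<in> borel_measurable (restrict_space borel Zs)"
    unfolding case_prod_unfold by (intro borel_measurable_SUP_continuous Zs continuous_on_ennreal)
  then have "(\<lambda>z. SUP (x, y). ennreal (norm (?\<phi> x z - ?\<phi> y z) / norm (x - y))) \<in> borel_measurable \<mu>z"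
    by (simp cong: measurable_cong_sets)
  \<comment> \<open>The supremum of quotients is identified with \<open>R\<close> on
    \<open>Zs\<close> only, where \<open>f\<close> is twice differentiable; this is all of the space
    of \<open>\<mu>z\<close>.\<close>
  then have R[measurable]: "R \<in> borel_measurable \<mu>z"
    by (rule measurable_cong[THEN iffD1, rotated])
      (simp add: R_def sp R_fun_eq_SUP_quotient[of f, OF f(1)])
  have id: "(\<lambda>z. z) \<in> \<mu>z \<rightarrow>\<^sub>M borel"
    unfolding measurable_cong_sets[OF mu(2) refl] by (rule measurable_restrict_space1) simp
  have diff: "(\<lambda>p. norm (fst p - snd p)) \<in> borel_measurable (\<mu>z \<Otimes>\<^sub>M \<mu>z)"
  proof -
    note [measurable] = measurable_compose[OF measurable_fst id] measurable_compose[OF measurable_snd id]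
    show ?thesis by measurable
  qed

  obtain xs where xs: "(\<integral>\<^sup>+\<omega>. R (Z 1 \<omega>) + ennreal (norm (grad (\<lambda>x. f x (Z 1 \<omega>)) xs)) \<partial>M) < \<infinity>"
    using i(1) by blast
  have intR: "(\<integral>\<^sup>+z. R z \<partial>\<mu>z) < \<infinity>"
  proof (rule order_le_less_trans)
    show "(\<integral>\<^sup>+z. R z \<partial>\<mu>z) \<le> (\<integral>\<^sup>+\<omega>. R (Z 1 \<omega>) + ennreal (norm (grad (\<lambda>x. f x (Z 1 \<omega>)) xs)) \<partial>M)"
      unfolding int_Z1[OF R] by (intro nn_integral_mono le_iff_add[THEN iffD2] exI) (rule refl)
  qed (rule xs)
  \<comment> \<open>The displacement divided by \<open>\<eta>\<close> is the gradient norm at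
    \<open>xs\<close>. It is kept in this form because measurability in the datum has been
    established for the step.\<close>
  have fin: "(\<integral>\<^sup>+z. norm (?\<phi> xs z - xs) \<partial>\<mu>z) < \<infinity>"
  proof -
    have "(\<integral>\<^sup>+z. norm (?\<phi> xs z - xs) \<partial>\<mu>z) = (\<integral>\<^sup>+z. ennreal \<eta> * ennreal (norm (?\<phi> xs z - xs) / \<eta>) \<partial>\<mu>z)"
      using eta by (simp flip: ennreal_mult)
    also have "\<dots> = ennreal \<eta> * (\<integral>\<^sup>+z. ennreal (norm (?\<phi> xs z - xs) / \<eta>) \<partial>\<mu>z)"
      by (rule nn_integral_cmult) simp
    also have "(\<integral>\<^sup>+z. ennreal (norm (?\<phi> xs z - xs) / \<eta>) \<partial>\<mu>z) = (\<integral>\<^sup>+\<omega>. ennreal (norm (?\<phi> xs (Z 1 \<omega>) - xs) / \<eta>) \<partial>M)"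
      by (rule int_Z1) simp
    also have "ennreal \<eta> * \<dots> \<le> ennreal \<eta> * (\<integral>\<^sup>+\<omega>. R (Z 1 \<omega>) + ennreal (norm (grad (\<lambda>x. f x (Z 1 \<omega>)) xs)) \<partial>M)"
      using eta by (intro mult_left_mono nn_integral_mono) (simp_all add: sgd_step_def)
    also have "\<dots> < \<infinity>" using xs by (simp add: ennreal_mult_less_top)
    finally show ?thesis .
  qed
  \<comment> \<open>Assumption \<open>beta\<close> concerns \<open>enn2real (R z)\<close>, which
    sends \<infinity> to 0. Almost sure finiteness of \<open>R\<close> shows that this real version
    has the same mean as \<open>R\<close>.\<close>
  have AEfin: "AE z in \<mu>z. ennreal (enn2real (R z)) = R z"
  proof -
    have "AE z in \<mu>z. R z \<noteq> \<infinity>"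
      using intR by (intro nn_integral_PInf_AE R) simp
    then show ?thesis by eventually_elim (simp add: less_top)
  qed
  have \<delta>: "(\<integral>\<^sup>+z. R z \<partial>\<mu>z) = ennreal \<delta>R" "0 \<le> \<delta>R"
    using intR int_Z1[OF R] by (simp_all add: \<delta>R_def R_def)
  have eq: "(\<integral>\<^sup>+z. ennreal (enn2real (R z)) \<partial>\<mu>z) = (\<integral>\<^sup>+z. R z \<partial>\<mu>z)"
    using AEfin by (rule nn_integral_cong_AE)
  have "(\<integral>\<^sup>+z. ennreal (enn2real (R z)) \<partial>\<mu>z) < 1"
  proof (rule mean_lt_one_of_powr_mean_eq_one[OF mu(1) _ _ _ beta(3)])
    show "(\<integral>\<^sup>+z. ennreal (enn2real (R z) powr \<beta>) \<partial>\<mu>z) = 1"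
      using beta(2) by (subst int_Z1) auto
    \<comment> \<open>Equality in the tangent inequality would make \<open>R\<close> almost surely
      equal to 1, against \<open>iv\<close>.\<close>
    show "\<not> (AE z in \<mu>z. enn2real (R z) = 1)"
    proof
      assume "AE z in \<mu>z. enn2real (R z) = 1"
      with AEfin have "AE z in \<mu>z. R z = 1" by eventually_elim auto
      then have "AE z in distr M \<mu>z (Z 1). R z = 1" unfolding sgd_online(3) .
      then have "AE \<omega> in M. R (Z 1 \<omega>) = 1" by (rule AE_distrD[OF Z1])
      then show False using iv by blast
    qed
    show "(\<lambda>z. enn2real (R z)) \<in> borel_measurable \<mu>z" by simp
    show "(\<integral>\<^sup>+z. ennreal (enn2real (R z)) \<partial>\<mu>z) < \<infinity>" using intR by (simp add: eq)
  qed simp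
  then have \<delta>1: "\<delta>R < 1" using \<delta> by (simp add: eq ennreal_less_one_iff)

  \<comment> \<open>The estimate is proved for each fixed dataset \<open>D\<close>, so that
    randomness of the data enters only through the event on which the offline chain is
    ergodic.\<close>
  have bound: "W1 \<pi> \<pi>n \<le> ((\<integral>\<^sup>+x. ennreal (norm x) \<partial>\<pi>n) + 1)
      * ennreal (L * (\<eta> / (1 - \<delta>R))) * W1 \<mu>z (\<mu>n D)"
    if D: "D \<in> {1..n} \<rightarrow>\<^sub>E Zs" and st': "stationary_distribution (sgd_kernel \<eta> f (\<mu>n D)) \<pi>n" for D \<pi>n
  proof -
    have "prob_space (\<mu>n D)"
      unfolding \<mu>n_def empirical_measure_def
    proof (rule prob_space.prob_space_distr)
      show "prob_space (uniform_count_measure {1..n})"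
        using n by (intro prob_space_uniform_count_measure) auto
      show "D \<in> uniform_count_measure {1..n} \<rightarrow>\<^sub>M \<mu>z"
        using D by (auto simp: measurable_def sp space_uniform_count_measure sets_uniform_count_measure)
    qed
    moreover have "sets (\<mu>n D) = sets \<mu>z"
      by (simp add: \<mu>n_def empirical_measure_def)
    moreover have "stationary_distribution (\<lambda>x. distr \<mu>z borel (?\<phi> x)) \<pi>"
      using v by (simp add: W1_geometrically_ergodic_to_def sgd_kernel_def[abs_def])
    moreover have "stationary_distribution (\<lambda>x. distr (\<mu>n D) borel (?\<phi> x)) \<pi>n"
      using st' by (simp add: sgd_kernel_def[abs_def])
    moreover have "ennreal (norm (?\<phi> x z - ?\<phi> y z)) \<le> R z * norm (x - y)" if "z \<in> space \<mu>z" for x y z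
      unfolding R_def using that by (intro sgd_step_lipschitz f(1)) (simp add: sp)
    \<comment> \<open>The perturbation bound is applied with \<open>c = \<eta> * L\<close> and with
      \<open>xs\<close> as the point of finite mean displacement.\<close>
    ultimately have "W1 \<pi> \<pi>n \<le> ((\<integral>\<^sup>+x. ennreal (norm x) \<partial>\<pi>n) + 1)
        * ennreal (\<eta> * L / (1 - \<delta>R)) * W1 \<mu>z (\<mu>n D)"
      using eta ii(1) noise
      by (intro W1_stationary_perturbation[OF mu(1) _ _ diff \<phi> _ _ R \<delta> \<delta>1 _ fin]) (auto simp: sp)
    then show ?thesis by (simp add: mult.commute)
  qed

  let ?bad = "{\<omega> \<in> space M. \<not> W1_ergodic (N (dataset \<omega>)) (Xn (dataset \<omega>)) (sgd_kernel \<eta> f (\<mu>n (dataset \<omega>)))}"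
  \<comment> \<open>The set of datasets with a non-ergodic chain need not be measurable. Its
    measurable hull \<open>E\<close> has the same outer measure, so the complement of
    \<open>E\<close> is an event of probability exactly \<open>1 - \<epsilon>\<close> on which the
    chain is ergodic.\<close>
  obtain E where E: "E \<in> sets M" "?bad \<subseteq> E" "outer_measure_of M ?bad = emeasure M E"
    using outer_measure_of_attain[of ?bad M] by auto
  have "measure M (space M - E) = 1 - \<epsilon>"
    using M.prob_compl[OF E(1)] unfolding eps E(3) measure_def[symmetric] .
  then have prob: "1 - \<epsilon> \<le> measure M (space M - E)" by simp
  \<comment> \<open>Measurability of \<open>Z j\<close> into \<open>\<mu>z\<close>, whose space is
    \<open>Zs\<close>, puts the data into \<open>Zs\<close> at every point and not just almost
    surely.\<close>
  have dataset: "dataset \<omega> \<in> {1..n} \<rightarrow>\<^sub>E Zs" if "\<omega> \<in> space M" for \<omega>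
  proof -
    have "Z j \<omega> \<in> Zs" if "j \<in> {1..n}" for j
      using measurable_space[OF Z, of j \<omega>] that \<open>\<omega> \<in> space M\<close> by (simp add: sp)
    then show ?thesis by (simp add: dataset_def)
  qed
  show ?thesis
  proof (intro bexI[of _ "space M - E"] conjI ballI)
    fix \<omega> assume \<omega>: "\<omega> \<in> space M - E"
    then have "W1_ergodic (N (dataset \<omega>)) (Xn (dataset \<omega>)) (sgd_kernel \<eta> f (\<mu>n (dataset \<omega>)))"
      using E(2) by blast
    then show "let D = dataset \<omega>; K = sgd_kernel \<eta> f (\<mu>n D) in
       W1_ergodic (N D) (Xn D) K \<and>
       (\<forall>\<pi>n. W1_ergodic_to (N D) (Xn D) K \<pi>n \<longrightarrow>
          W1 \<pi> \<pi>n \<le> ((\<integral>\<^sup>+x. ennreal (norm x) \<partial>\<pi>n) + 1)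
            * ennreal (L * (\<eta> / (1 - \<delta>R))) * W1 \<mu>z (\<mu>n D))"
      unfolding Let_def W1_ergodic_to_def
    proof (intro conjI allI impI; (elim conjE)?)
      fix \<pi>n assume "stationary_distribution (sgd_kernel \<eta> f (\<mu>n (dataset \<omega>))) \<pi>n"
      with dataset \<omega> show "W1 \<pi> \<pi>n \<le> ((\<integral>\<^sup>+x. ennreal (norm x) \<partial>\<pi>n) + 1)
          * ennreal (L * (\<eta> / (1 - \<delta>R))) * W1 \<mu>z (\<mu>n (dataset \<omega>))"
        by (intro bound) auto
    qed
  qed (use prob E(1) in simp_all)
qed

end
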